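(* Let $\kappa>0$ and $\alpha=\frac{1}{1+\kappa}$. Consider the erasure queue-channel with binary input alphabet, erasure probability $p(W)=1-\exp(-\kappa W)$, Poisson arrivals of rate $\lambda\in(0,1)$ (interarrival distribution $F_A(x)=1-\exp(-\lambda x)$) and exponential service times $F_S(x)=1-\exp(-x)$. Then (i) the capacity is $\frac{\lambda(1-\lambda)}{1-\alpha\lambda}$ bits/sec; (ii) over $\lambda\in(0,1)$, the capacity is maximized at $$\lambda_{\mathsf{M}/\mathsf{M}/1}=\frac{1}{\alpha}\left(1-\sqrt{1-\alpha}\right)=\frac{1}{1+\sqrt{1-\alpha}}.$$
   Context: Queue. Symbols (qubits) $j=1,2,\dots$ arrive at a single-server FIFO queue. Interarrival times are i.i.d. with distribution $F_A$; service times $S_j$ are i.i.d. with distribution $F_S$, independent of the arrivals. The first symbol arrives to an empty system. $A_j$ is the arrival time of symbol $j$, $D_j$ is the time it leaves the waiting line (its service start), and $W_j=D_j-A_j$ is its waiting time. Thus $W_1=0$ and $W_{j+1}=\max(W_j+S_j-(A_{j+1}-A_j),0)$. Channel. The inputs $X^n=(X_1,\dots,X_n)$, with values in the input alphabet $\mathcal{X}$, are independent of the arrival and service times. Given $X^n$ and all arrival and service times, the outputs $Y_1,\dots,Y_n$ are independent, with $Y_j=X_j$ with probability $1-p(W_j)$ and $Y_j=\mathcal{E}$ (an erasure symbol not in $\mathcal{X}$) with probability $p(W_j)$. Capacity. An $(n,\tilde R,T)$ code consists of a message set $\mathcal{M}$ with $|\mathcal{M}|=2^{n\tilde R}$, an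 encoder $X^n=f(M)$ and a decoder $\hat M=g(\cdot)$ acting on $(Y^n,A^n,D^n)$ if the receiver knows the arrival and departure times, and on $Y^n$ only if it does not (the claim is meant in either case); $M$ is uniform on $\mathcal{M}$ and the expected time by which all $n$ symbols have been served is less than $T$. A rate $R$ is achievable if for all $\epsilon\in(0,1)$ and $\delta>0$, for all sufficiently large $n$ there is an $(n,\tilde R,T)$ code with $\Pr[\hat M\ne M]<\epsilon$ and $n\tilde R/T>R-\delta$. The capacity is the supremum of achievable rates. *)

theory Defs
  imports "HOL-Probability.Probability"
begin

text \<open>
  Symbols are numbered from 0, so the symbols \<open>1, \<dots>, n\<close> of a block are the indices in \<open>{..<n}\<close>.
  \<open>\<tau> i\<close> is the time between the arrivals of the symbols \<open>i - 1\<close> and \<open>i\<close> (with \<open>\<tau> 0\<close> counted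
  from time 0), and \<open>s i\<close> is the service time of symbol \<open>i\<close>.
\<close>

definition arrival :: "(nat \<Rightarrow> real) \<Rightarrow> nat \<Rightarrow> real" where
  "arrival \<tau> j = (\<Sum>i\<le>j. \<tau> i)"

text \<open>
  The departure from the waiting line is the start of service: a symbol is served on arrival, or
  when the service of its predecessor ends if that is later.
\<close>

fun departure :: "(nat \<Rightarrow> real) \<Rightarrow> (nat \<Rightarrow> real) \<Rightarrow> nat \<Rightarrow> real" where
  "departure \<tau> s 0 = arrival \<tau> 0"
| "departure \<tau> s (Suc j) = max (arrival \<tau> (Suc j)) (departure \<tau> s j + s j)"

definition waiting :: "(nat \<Rightarrow> real) \<Rightarrow> (nat \<Rightarrow> real) \<Rightarrow> nat \<Rightarrow> real" where
  "waiting \<tau> s j = departure \<tau> s j - arrival \<tau> j"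

lemma waiting_0: "waiting \<tau> s 0 = 0"
  by (simp add: waiting_def)

lemma waiting_Suc:
  "waiting \<tau> s (Suc j) =
     max (waiting \<tau> s j + s j - (arrival \<tau> (Suc j) - arrival \<tau> j)) 0"
  by (simp add: waiting_def max_def)

lemma waiting_nonneg: "0 \<le> waiting \<tau> s j"
  by (cases j) (simp_all add: waiting_0 waiting_Suc)

text \<open>Service is in order of arrival, so all \<open>n\<close> symbols are served when the last one is.\<close>

definition completion :: "nat \<Rightarrow> (nat \<Rightarrow> real) \<Rightarrow> (nat \<Rightarrow> real) \<Rightarrow> real" where
  "completion n \<tau> s = departure \<tau> s (n - 1) + s (n - 1)"

definition exponential_law :: "real \<Rightarrow> real measure" where
  "exponential_law l = density lborel (\<lambda>x. ennreal (exponential_density l x))"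

lemma prob_space_exponential_law: "0 < l \<Longrightarrow> prob_space (exponential_law l)"
  unfolding exponential_law_def by (rule prob_space_exponential_density)

lemma sets_exponential_law: "sets (exponential_law l) = sets borel"
  by (simp add: exponential_law_def)

lemma cdf_exponential_law:
  assumes "0 < l"
  shows "cdf (exponential_law l) x = (if x < 0 then 0 else 1 - exp (- l * x))"
proof -
  interpret prob_space "exponential_law l"
    using assms by (rule prob_space_exponential_law)
  have D: "distributed (exponential_law l) lborel (\<lambda>x. x) (\<lambda>x. ennreal (exponential_density l x))"
    unfolding distributed_def exponential_law_def by (auto intro!: distr_id2)
  have eq: "prob {..a} = 1 - exp (- a * l)" if "0 \<le> a" for a
    using exponential_distributedD_le[OF D that assms]
    by (simp add: exponential_law_def atMost_def)
  show ?thesis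
  proof (cases "x < 0")
    case True
    then have "prob {..x} \<le> prob {..0}"
      by (intro finite_measure_mono) (auto simp: sets_exponential_law)
    with eq[of 0] True show ?thesis
      by (simp add: cdf_def measure_le_0_iff)
  next
    case False
    with eq[of x] show ?thesis
      by (simp add: cdf_def mult.commute)
  qed
qed

text \<open>
  The distributions \<open>FA\<close> of the interarrival times and \<open>FS\<close> of the service times are given as
  probability measures on the reals.
\<close>

definition timing_law ::
    "real measure \<Rightarrow> real measure \<Rightarrow> nat \<Rightarrow> ((nat \<Rightarrow> real) \<times> (nat \<Rightarrow> real)) measure" where
  "timing_law FA FS n = Pi\<^sub>M {..<n} (\<lambda>_. FA) \<Otimes>\<^sub>M Pi\<^sub>M {..<n} (\<lambda>_. FS)"

text \<open>\<^const>\<open>None\<close> is the erasure symbol.\<close>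

definition erase :: "real \<Rightarrow> 'x \<Rightarrow> 'x option pmf" where
  "erase q x = map_pmf (\<lambda>e. if e then None else Some x) (bernoulli_pmf q)"

definition output_space :: "nat \<Rightarrow> (nat \<Rightarrow> 'x option) measure" where
  "output_space n = Pi\<^sub>M {..<n} (\<lambda>_. count_space UNIV)"

definition channel_law ::
    "(real \<Rightarrow> real) \<Rightarrow> nat \<Rightarrow> (nat \<Rightarrow> 'x) \<Rightarrow> (nat \<Rightarrow> real) \<Rightarrow> (nat \<Rightarrow> real)
      \<Rightarrow> (nat \<Rightarrow> 'x option) measure" where
  "channel_law p n x \<tau> s = Pi\<^sub>M {..<n} (\<lambda>j. measure_pmf (erase (p (waiting \<tau> s j)) (x j)))"

text \<open>
  The joint law of the message, the interarrival and service times, and the outputs, for a message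
  uniform on \<open>MM\<close> (independent of the queue) and the encoder \<open>f\<close>.
\<close>

definition joint_law ::
    "(real \<Rightarrow> real) \<Rightarrow> real measure \<Rightarrow> real measure \<Rightarrow> nat \<Rightarrow> nat set \<Rightarrow> (nat \<Rightarrow> nat \<Rightarrow> 'x)
      \<Rightarrow> ((nat \<times> (nat \<Rightarrow> real) \<times> (nat \<Rightarrow> real)) \<times> (nat \<Rightarrow> 'x option)) measure" where
  "joint_law p FA FS n MM f =
     (let P = uniform_count_measure MM \<Otimes>\<^sub>M timing_law FA FS n
      in P \<bind> (\<lambda>(m, \<tau>, s). channel_law p n (f m) \<tau> s \<bind>
           (\<lambda>y. return (P \<Otimes>\<^sub>M output_space n) ((m, \<tau>, s), y))))"

text \<open>
  The law is well defined whenever \<open>p\<close> is Borel and \<open>FA\<close>, \<open>FS\<close> are Borel probability measures.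
\<close>

lemma measurable_arrival:
  "j < n \<Longrightarrow> (\<lambda>\<tau>. arrival \<tau> j) \<in> borel_measurable (Pi\<^sub>M {..<n} (\<lambda>_. borel))"
  unfolding arrival_def by (intro borel_measurable_sum measurable_component_singleton) auto

lemma measurable_departure:
  "j < n \<Longrightarrow> (\<lambda>(\<tau>, s). departure \<tau> s j)
     \<in> borel_measurable (Pi\<^sub>M {..<n} (\<lambda>_. borel) \<Otimes>\<^sub>M Pi\<^sub>M {..<n} (\<lambda>_. borel))"
proof (induction j)
  case 0
  note [measurable] = measurable_arrival[OF 0]
  show ?case by simp
next
  case (Suc j)
  then have j: "j < n" by simp
  note [measurable] = measurable_arrival[OF Suc.prems] Suc.IH[OF j]
  have [measurable]: "(\<lambda>s. s j) \<in> borel_measurable (Pi\<^sub>M {..<n} (\<lambda>_. borel :: real measure))"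
    using j by (intro measurable_component_singleton) auto
  show ?case by simp
qed

lemma sets_timing_law:
  assumes "sets FA = sets borel" "sets FS = sets borel"
  shows "sets (timing_law FA FS n)
    = sets (Pi\<^sub>M {..<n} (\<lambda>_. borel) \<Otimes>\<^sub>M Pi\<^sub>M {..<n} (\<lambda>_. borel))"
  unfolding timing_law_def using assms by (intro sets_pair_measure_cong sets_PiM_cong) auto

lemma measurable_erase:
  assumes [measurable]: "q \<in> borel_measurable M"
  shows "(\<lambda>z. emeasure (measure_pmf (erase (q z) x)) A) \<in> borel_measurable M"
proof -
  let ?c = "\<lambda>z. max 0 (min 1 (q z))"
  have "emeasure (measure_pmf (erase (q z) x)) A
      = indicator A None * ennreal (?c z) + indicator A (Some x) * ennreal (1 - ?c z)" for z
  proof -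
    have "bernoulli_pmf (q z) = bernoulli_pmf (?c z)"
      unfolding bernoulli_pmf_def map_fun_def comp_def id_def
      by (intro arg_cong[where f=embed_pmf]) (auto simp: min_def max_def)
    moreover have "emeasure (measure_pmf (erase (q z) x)) A
        = (\<integral>\<^sup>+y. indicator A y \<partial>measure_pmf (erase (q z) x))"
      by simp
    ultimately show ?thesis
      unfolding erase_def by (simp del: nn_integral_indicator)
  qed
  then show ?thesis by simp
qed

lemma measurable_channel_law:
  fixes f :: "nat \<Rightarrow> nat \<Rightarrow> 'x"
  assumes [measurable]: "p \<in> borel_measurable borel"
    and A: "sets FA = sets borel" and S: "sets FS = sets borel"
  shows "(\<lambda>(m, \<tau>, s). channel_law p n (f m) \<tau> s)
    \<in> uniform_count_measure MM \<Otimes>\<^sub>M timing_law FA FS n \<rightarrow>\<^sub>M prob_algebra (output_space n)"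
    (is "?K \<in> ?P \<rightarrow>\<^sub>M _")
proof (rule measurable_prob_algebra_generated)
  let ?N = "\<lambda>_. count_space (UNIV :: 'x option set)"
  let ?G = "{Pi\<^sub>E {..<n} E | E. \<forall>i\<in>{..<n}. E i \<in> sets (?N i)}"
  have "prod_algebra {..<n} ?N = ?G"
    by (subst prod_algebra_eq_finite) (auto simp: Pi_def)
  then show "sets (output_space n) = sigma_sets (\<Pi>\<^sub>E i\<in>{..<n}. space (?N i)) ?G"
    unfolding output_space_def sets_PiM by simp
  show "Int_stable ?G" by (rule Int_stable_PiE)
  show "?G \<subseteq> Pow (\<Pi>\<^sub>E i\<in>{..<n}. space (?N i))" by (auto simp: PiE_def)
  show "prob_space (?K z)" for z
    by (auto simp: channel_law_def split: prod.split intro!: prob_space_PiM prob_space_measure_pmf)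
  show "sets (?K z) = sets (output_space n)" for z
    by (auto simp: channel_law_def output_space_def split: prod.split intro!: sets_PiM_cong)
  fix B assume "B \<in> ?G"
  then obtain E where B: "B = Pi\<^sub>E {..<n} E" by auto
  have *: "emeasure (?K z) B = (\<Prod>j<n. emeasure (measure_pmf
      (erase (p (waiting (fst (snd z)) (snd (snd z)) j)) (f (fst z) j))) (E j))" for z
  proof -
    interpret product_prob_space "\<lambda>j. measure_pmf
        (erase (p (waiting (fst (snd z)) (snd (snd z)) j)) (f (fst z) j))" UNIV
      by unfold_locales
    show ?thesis unfolding B channel_law_def
      by (simp add: case_prod_beta emeasure_PiM)
  qed
  have [measurable]: "(\<lambda>z. waiting (fst (snd z)) (snd (snd z)) j) \<in> borel_measurable ?P"
    if "j < n" for j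
  proof -
    note [measurable] = measurable_arrival[OF that] measurable_departure[OF that, unfolded case_prod_beta]
    have "(\<lambda>z. waiting (fst z) (snd z) j) \<in> borel_measurable (timing_law FA FS n)"
      unfolding waiting_def measurable_cong_sets[OF sets_timing_law[OF A S] refl] by measurable
    from measurable_compose[OF measurable_snd this] show ?thesis .
  qed
  have "(\<lambda>z. emeasure (measure_pmf
      (erase (p (waiting (fst (snd z)) (snd (snd z)) j)) (f (fst z) j))) (E j)) \<in> borel_measurable ?P"
    if "j < n" for j
  proof (rule measurable_compose_countable[where g=fst])
    show "(\<lambda>z. emeasure (measure_pmf
        (erase (p (waiting (fst (snd z)) (snd (snd z)) j)) (f i j))) (E j)) \<in> borel_measurable ?P" for i
      using that by (intro measurable_erase) measurable
    have "fst \<in> ?P \<rightarrow>\<^sub>M uniform_count_measure MM" by measurable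
    then show "fst \<in> ?P \<rightarrow>\<^sub>M count_space UNIV"
      by (rule measurable_compose) (auto simp: measurable_def sets_uniform_count_measure space_uniform_count_measure)
  qed
  then show "(\<lambda>z. emeasure (?K z) B) \<in> borel_measurable ?P"
    unfolding * by (intro borel_measurable_prod_ennreal) auto
qed

lemma
  fixes f :: "nat \<Rightarrow> nat \<Rightarrow> 'x"
  assumes p: "p \<in> borel_measurable borel"
    and A: "prob_space FA" "sets FA = sets borel" and S: "prob_space FS" "sets FS = sets borel"
    and MM: "finite MM" "MM \<noteq> {}"
  shows prob_space_joint_law: "prob_space (joint_law p FA FS n MM f)"
    and sets_joint_law: "sets (joint_law p FA FS n MM f)
      = sets ((uniform_count_measure MM \<Otimes>\<^sub>M timing_law FA FS n) \<Otimes>\<^sub>M output_space n)"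
proof -
  let ?P = "uniform_count_measure MM \<Otimes>\<^sub>M timing_law FA FS n"
  interpret T1: prob_space "Pi\<^sub>M {..<n} (\<lambda>_. FA)" by (intro prob_space_PiM A)
  interpret T2: prob_space "Pi\<^sub>M {..<n} (\<lambda>_. FS)" by (intro prob_space_PiM S)
  interpret T: pair_prob_space "Pi\<^sub>M {..<n} (\<lambda>_. FA)" "Pi\<^sub>M {..<n} (\<lambda>_. FS)" ..
  interpret M: prob_space "uniform_count_measure MM"
    using MM by (rule prob_space_uniform_count_measure)
  interpret T': prob_space "timing_law FA FS n"
    unfolding timing_law_def by (rule T.prob_space_axioms)
  interpret P: pair_prob_space "uniform_count_measure MM" "timing_law FA FS n" ..
  have P: "?P \<in> space (prob_algebra ?P)"
    by (simp add: space_prob_algebra P.prob_space_axioms)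
  note K = measurable_channel_law[OF p A(2) S(2), of n f MM]
  have "(\<lambda>z. (case z of (m, \<tau>, s) \<Rightarrow> channel_law p n (f m) \<tau> s) \<bind>
      (\<lambda>y. return (?P \<Otimes>\<^sub>M output_space n) (z, y)))
    \<in> ?P \<rightarrow>\<^sub>M prob_algebra (?P \<Otimes>\<^sub>M output_space n)"
    by (rule measurable_bind_prob_space2[OF K]) (simp add: case_prod_beta measurable_return_prob_space)
  moreover have "joint_law p FA FS n MM f = ?P \<bind>
      (\<lambda>z. (case z of (m, \<tau>, s) \<Rightarrow> channel_law p n (f m) \<tau> s) \<bind>
      (\<lambda>y. return (?P \<Otimes>\<^sub>M output_space n) (z, y)))"
    unfolding joint_law_def Let_def
    by (intro arg_cong[where f="bind ?P"] ext) (simp split: prod.split)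
  ultimately show "prob_space (joint_law p FA FS n MM f)"
    and "sets (joint_law p FA FS n MM f) = sets (?P \<Otimes>\<^sub>M output_space n)"
    by (simp_all only: prob_space_bind'[OF P] sets_bind'[OF P])
qed

text \<open>Whether the receiver observes the arrival and departure times.\<close>

datatype receiver = Times_Known | Times_Unknown

text \<open>
  A decoder is a measurable function of the triple \<open>(Y\<^sup>n, A\<^sup>n, D\<^sup>n)\<close>, which is constant in
  \<open>(A\<^sup>n, D\<^sup>n)\<close> if the receiver does not know these times.
\<close>

definition decoder ::
    "receiver \<Rightarrow> nat \<Rightarrow> ((nat \<Rightarrow> 'x option) \<times> (nat \<Rightarrow> real) \<times> (nat \<Rightarrow> real) \<Rightarrow> nat) \<Rightarrow> bool" where
  "decoder r n g \<longleftrightarrow>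
     g \<in> output_space n \<Otimes>\<^sub>M Pi\<^sub>M {..<n} (\<lambda>_. borel) \<Otimes>\<^sub>M Pi\<^sub>M {..<n} (\<lambda>_. borel)
           \<rightarrow>\<^sub>M count_space UNIV
     \<and> (r = Times_Unknown \<longrightarrow> (\<exists>h. \<forall>y a d. g (y, a, d) = h y))"

definition error_prob ::
    "(real \<Rightarrow> real) \<Rightarrow> real measure \<Rightarrow> real measure \<Rightarrow> nat \<Rightarrow> nat set \<Rightarrow> (nat \<Rightarrow> nat \<Rightarrow> 'x)
      \<Rightarrow> ((nat \<Rightarrow> 'x option) \<times> (nat \<Rightarrow> real) \<times> (nat \<Rightarrow> real) \<Rightarrow> nat) \<Rightarrow> real" where
  "error_prob p FA FS n MM f g =
     \<P>(((m, \<tau>, s), y) in joint_law p FA FS n MM f.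
        g (y, restrict (arrival \<tau>) {..<n}, restrict (departure \<tau> s) {..<n}) \<noteq> m)"

lemma error_event_measurable:
  assumes g: "decoder r n g" and p: "p \<in> borel_measurable borel"
    and A: "prob_space FA" "sets FA = sets borel" and S: "prob_space FS" "sets FS = sets borel"
    and MM: "finite MM" "MM \<noteq> {}"
  shows "{z \<in> space (joint_law p FA FS n MM f). case z of ((m, \<tau>, s), y) \<Rightarrow>
      g (y, restrict (arrival \<tau>) {..<n}, restrict (departure \<tau> s) {..<n}) \<noteq> m}
    \<in> sets (joint_law p FA FS n MM f)"
proof -
  let ?B = "Pi\<^sub>M {..<n} (\<lambda>_. borel :: real measure)"
  let ?J = "(count_space MM \<Otimes>\<^sub>M (?B \<Otimes>\<^sub>M ?B)) \<Otimes>\<^sub>M output_space n"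
  have sets: "sets (joint_law p FA FS n MM f) = sets ?J"
    unfolding sets_joint_law[OF p A S MM]
    by (intro sets_pair_measure_cong sets_timing_law A S sets_uniform_count_measure_count_space refl)
  have [measurable]: "g \<in> output_space n \<Otimes>\<^sub>M ?B \<Otimes>\<^sub>M ?B \<rightarrow>\<^sub>M count_space UNIV"
    using g by (simp add: decoder_def)
  have [measurable]: "(\<lambda>\<tau>. restrict (arrival \<tau>) {..<n}) \<in> ?B \<rightarrow>\<^sub>M ?B"
    by (intro measurable_restrict measurable_arrival) auto
  have [measurable]: "(\<lambda>t. restrict (departure (fst t) (snd t)) {..<n}) \<in> ?B \<Otimes>\<^sub>M ?B \<rightarrow>\<^sub>M ?B"
    using measurable_departure by (intro measurable_restrict) (auto simp: case_prod_beta)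
  have [measurable]: "(\<lambda>m. m) \<in> count_space MM \<rightarrow>\<^sub>M count_space UNIV" by simp
  have d: "(\<lambda>z. restrict (departure (fst (snd (fst z))) (snd (snd (fst z)))) {..<n}) \<in> ?J \<rightarrow>\<^sub>M ?B"
    by (rule measurable_compose[of "\<lambda>z. snd (fst z)" ?J "?B \<Otimes>\<^sub>M ?B"
          "\<lambda>t. restrict (departure (fst t) (snd t)) {..<n}"]) measurable
  note [measurable] = d
  have m: "(\<lambda>z. fst (fst z)) \<in> ?J \<rightarrow>\<^sub>M count_space UNIV"
    by (rule measurable_compose[of "\<lambda>z. fst (fst z)" ?J "count_space MM" "\<lambda>m. m"]) measurable
  have "(\<lambda>z. g (snd z, restrict (arrival (fst (snd (fst z)))) {..<n},
      restrict (departure (fst (snd (fst z))) (snd (snd (fst z)))) {..<n})) \<in> ?J \<rightarrow>\<^sub>M count_space UNIV"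
    by measurable
  note [measurable] = this
  have "Measurable.pred ?J (\<lambda>z. g (snd z, restrict (arrival (fst (snd (fst z)))) {..<n},
      restrict (departure (fst (snd (fst z))) (snd (snd (fst z)))) {..<n}) \<noteq> fst (fst z))"
    by (rule measurable_compose_countable[OF _ m]) measurable
  then show ?thesis
    unfolding sets sets_eq_imp_space_eq[OF sets] case_prod_beta by (rule predE)
qed

text \<open>
  \<open>code XX FA FS r n R T MM f g\<close>: an \<open>(n, R, T)\<close> code over the alphabet \<open>XX\<close> with message set
  \<open>MM\<close>, encoder \<open>f\<close> and decoder \<open>g\<close>.
\<close>

definition code ::
    "'x set \<Rightarrow> real measure \<Rightarrow> real measure \<Rightarrow> receiver \<Rightarrow> nat \<Rightarrow> real \<Rightarrow> real
      \<Rightarrow> nat set \<Rightarrow> (nat \<Rightarrow> nat \<Rightarrow> 'x)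
      \<Rightarrow> ((nat \<Rightarrow> 'x option) \<times> (nat \<Rightarrow> real) \<times> (nat \<Rightarrow> real) \<Rightarrow> nat) \<Rightarrow> bool" where
  "code XX FA FS r n R T MM f g \<longleftrightarrow>
     finite MM \<and> real (card MM) = 2 powr (real n * R)
     \<and> (\<forall>m\<in>MM. \<forall>j<n. f m j \<in> XX)
     \<and> decoder r n g
     \<and> (\<integral>\<^sup>+(\<tau>, s). ennreal (completion n \<tau> s) \<partial>timing_law FA FS n) < ennreal T"

definition achievable ::
    "'x set \<Rightarrow> (real \<Rightarrow> real) \<Rightarrow> real measure \<Rightarrow> real measure \<Rightarrow> receiver \<Rightarrow> real \<Rightarrow> bool" where
  "achievable XX p FA FS r R \<longleftrightarrow>
     (\<forall>\<epsilon>\<in>{0<..<1}. \<forall>\<delta>>0. \<forall>\<^sub>F n in sequentially.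
        \<exists>R' T MM f g. code XX FA FS r n R' T MM f g
          \<and> error_prob p FA FS n MM f g < \<epsilon> \<and> real n * R' / T > R - \<delta>)"

text \<open>
  The supremum is taken in the extended reals, so that a finite capacity includes the assertion
  that the set of achievable rates is nonempty and bounded above.
\<close>

definition capacity ::
    "'x set \<Rightarrow> (real \<Rightarrow> real) \<Rightarrow> real measure \<Rightarrow> real measure \<Rightarrow> receiver \<Rightarrow> ereal" where
  "capacity XX p FA FS r = (SUP R\<in>{R. achievable XX p FA FS r R}. ereal R)"

end

theory Submission
  imports Defs
begin

text \<open>
  Let \<open>S\<close> be the set of the symbols of a block that are not erased, and \<open>\<rho>\<close> the stationary mean of
  \<open>exp (- \<kappa> W)\<close>. Given \<open>S\<close> and the timing, at most \<open>2 ^ card S\<close> messages can be decoded correctly,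
  and a random codebook with \<open>M\<close> words fails with probability at most \<open>M / 2 ^ card S\<close>. So both
  directions follow once \<open>card S / n\<close> tends to \<open>\<rho>\<close> in probability, as a block takes time about
  \<open>n / l\<close>. Knowing the times does not help the receiver, because the erasures are visible.

  The law of large numbers for \<open>card S\<close> needs no ergodic theory: the Poisson equation of the
  sojourn time chain has the explicit solution \<open>H\<close>, a combination of \<open>v\<close> and \<open>exp (- \<kappa> v)\<close>, so that
  the sum of the \<open>exp (- \<kappa> W\<^sub>j) - \<rho>\<close> is a martingale with bounded increment variances up to the
  boundary term \<open>H (V\<^sub>n)\<close>, whose second moment is \<open>O(n)\<close>.
\<close>

section \<open>Exponential interarrival and service times\<close>

text \<open>The waiting times are dependent and start from an empty system, so \<open>card S\<close>
  is neither a sum of independent variables nor a stationary one. Its deviation from n \<rho> has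
  two sources, which are treated separately: given the timing, the erasures are independent, with
  total variance at most n; and their mean given the timing fluctuates with the queue. Only second
  moments are used, and linear growth of both is enough, since Chebyshev divides by n^2. That so
  simple an \<open>H\<close> exists is due to the exponential laws. One step subtracts an
  exponential time, truncates at 0 and adds an exponential time; on v and exp (- \<kappa> v) this
  reproduces the same two functions, a constant, and a truncation term in exp (- l v). Matching exp
  (- \<kappa> v) fixes its coefficient, the coefficient of v then removes the truncation term, and
  the constant left over is \<rho>. Stability, l < 1, enters through the drift: the second moment of
  the sojourn time gains at most a constant per step.\<close>

lemma borel_measurable_exponential_law [simp]:
  "borel_measurable (exponential_law l) = borel_measurable borel"
  by (rule measurable_cong_sets) (simp_all add: sets_exponential_law)

lemma space_exponential_law [simp]: "space (exponential_law l) = UNIV"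
  by (simp add: exponential_law_def)

lemma distributed_exponential_law:
  "distributed (exponential_law l) lborel (\<lambda>t. t) (exponential_density l)"
  unfolding distributed_def exponential_law_def by (auto intro!: distr_id2)

lemma AE_exponential_law_nonneg: "0 < l \<Longrightarrow> AE t in exponential_law l. 0 \<le> t"
  unfolding exponential_law_def by (subst AE_density) (auto simp: exponential_density_def)

lemma has_bochner_integral_exponential_moment:
  "0 < l \<Longrightarrow> has_bochner_integral (exponential_law l) (\<lambda>t. t ^ i) (fact i / l ^ i)"
  using prob_space.has_bochner_integral_erlang_ith_moment[OF prob_space_exponential_law _
      distributed_exponential_law, of l i] by simp

text \<open>Cutting at t = v: on [0, v] the fundamental theorem of calculus gives
  \<open>F v - F 0\<close>; beyond v the residual is 0, so \<open>\<phi> 0\<close> is weighted with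
  the tail mass exp (- l v). The antiderivative is a parameter, so that one valid for \<kappa> = l
  as well can be supplied.\<close>

lemma exponential_law_residual:
  fixes F \<phi> :: "real \<Rightarrow> real"
  assumes l: "0 < l" and v: "0 \<le> v"
    and F: "\<And>t. (F has_real_derivative l * exp (- l * t) * \<phi> (v - t)) (at t)"
    and \<phi>: "\<And>w. isCont \<phi> w"
  shows "has_bochner_integral (exponential_law l) (\<lambda>t. \<phi> (max (v - t) 0))
    (F v - F 0 + \<phi> 0 * exp (- l * v))"
proof -
  interpret prob_space "exponential_law l" using l by (rule prob_space_exponential_law)
  have [measurable]: "\<phi> \<in> borel_measurable borel"
    using \<phi> by (intro borel_measurable_continuous_onI continuous_at_imp_continuous_on) auto
  have c: "isCont (\<lambda>t. l * exp (- l * t) * \<phi> (v - t)) t" for t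
    by (intro continuous_intros isCont_o2[OF _ \<phi>])
  have "has_bochner_integral lborel (\<lambda>t. l * exp (- l * t) * \<phi> (v - t) * indicator {0..v} t) (F v - F 0)"
    by (rule has_bochner_integral_FTC_Icc_real[OF v F c])
  then have "has_bochner_integral lborel
      (\<lambda>t. exponential_density l t *\<^sub>R (\<phi> (v - t) * indicator {0..v} t)) (F v - F 0)"
    by (rule has_bochner_integral_cong[THEN iffD1, rotated -1])
       (auto simp: exponential_density_def mult_ac split: split_indicator)
  then have "has_bochner_integral (exponential_law l) (\<lambda>t. \<phi> (v - t) * indicator {0..v} t) (F v - F 0)"
    unfolding exponential_law_def
    by (intro has_bochner_integral_density) (use l in \<open>auto simp: exponential_density_nonneg\<close>)
  moreover have "measure (exponential_law l) {v<..} = exp (- l * v)"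
    using exponential_distributedD_gt[OF distributed_exponential_law v l]
    by (simp add: greaterThan_def mult.commute)
  then have "has_bochner_integral (exponential_law l) (\<lambda>t. \<phi> 0 * indicator {v<..} t) (\<phi> 0 * exp (- l * v))"
    by (auto simp: has_bochner_integral_iff sets_exponential_law emeasure_eq_measure)
  ultimately have "has_bochner_integral (exponential_law l)
      (\<lambda>t. \<phi> (v - t) * indicator {0..v} t + \<phi> 0 * indicator {v<..} t) (F v - F 0 + \<phi> 0 * exp (- l * v))"
    by (rule has_bochner_integral_add)
  then show ?thesis
    by (rule has_bochner_integral_cong_AE[THEN iffD1, rotated -1])
       (use AE_exponential_law_nonneg[OF l] in \<open>auto split: split_indicator simp: max_def elim!: eventually_mono\<close>)
qed

section \<open>The Poisson equation of the sojourn time chain\<close>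

locale mm1 =
  fixes \<kappa> l :: real
  assumes \<kappa>: "0 < \<kappa>" and l: "0 < l" "l < 1"
begin

definition "\<alpha> = 1 / (1 + \<kappa>)"
definition "\<rho> = (1 - l) / (1 - \<alpha> * l)"
definition "\<beta> = 1 / (\<kappa> * (1 - \<alpha> * l))"
text \<open>
  The coefficients of \<open>v\<close> and \<open>exp (- \<kappa> v)\<close> are the ones for which the terms in \<open>exp (- l v)\<close>
  cancel in \<open>poisson_equation\<close>; they also cover the resonant case \<open>\<kappa> = l\<close>.
\<close>

definition "H v = - l * \<beta> * (\<kappa> * v + exp (- \<kappa> * v))"

lemma \<alpha>: "0 < \<alpha>" "\<alpha> < 1" "\<alpha> * l < 1"
proof -
  show "0 < \<alpha>" "\<alpha> < 1" using \<kappa> by (auto simp: \<alpha>_def)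
  then show "\<alpha> * l < 1" using l by (metis mult_less_cancel_right2 mult.commute less_trans mult_strict_mono' less_eq_real_def mult_1)
qed

lemma \<beta>_pos: "0 < \<beta>" using \<kappa> \<alpha> by (simp add: \<beta>_def)

text \<open>This equation determines \<beta>: on the left is the coefficient of exp (- \<kappa> W)
  in the Poisson equation once the service time is averaged out, on the right the one that
  \<open>poisson_interarrival\<close> requires. It rests on \<kappa> \<alpha> = 1 -
  \<alpha>.\<close>

lemma \<beta>_eq: "1 - l * \<beta> * \<alpha> = \<beta> * (\<kappa> - l)"
proof -
  have "\<kappa> * (1 - \<alpha> * l) = \<kappa> - l + l * \<alpha>" using \<kappa> by (simp add: \<alpha>_def field_simps)
  moreover have "\<beta> * (\<kappa> * (1 - \<alpha> * l)) = 1" using \<kappa> \<alpha> by (simp add: \<beta>_def)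
  ultimately have "\<beta> * (\<kappa> - l + l * \<alpha>) = 1" by (simp only:)
  then show ?thesis by (simp add: algebra_simps)
qed

text \<open>The form in which \<rho> appears in the Poisson equation:
  \<open>\<beta> * \<kappa>\<close> is the constant from averaging over the interarrival time, and
  \<open>l * \<beta> * \<kappa>\<close> is lost to the mean service time 1 in the linear part of
  \<open>H\<close>.\<close>

lemma \<rho>_eq: "\<rho> = \<beta> * \<kappa> * (1 - l)" using \<kappa> by (simp add: \<rho>_def \<beta>_def)

lemma \<rho>: "0 < \<rho>" "\<rho> < 1"
proof -
  show "0 < \<rho>" using \<alpha> l by (simp add: \<rho>_def)
  have "\<alpha> * l < l" using \<alpha> l by simp
  then show "\<rho> < 1" using \<alpha> l by (simp add: \<rho>_def)
qed

lemma poisson_interarrival: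
  assumes v: "0 \<le> v"
  shows "has_bochner_integral (exponential_law l)
    (\<lambda>t. \<beta> * (\<kappa> - l) * exp (- \<kappa> * max (v - t) 0) - l * \<beta> * \<kappa> * max (v - t) 0)
    (H v + \<beta> * \<kappa>)"
proof -
  let ?\<phi> = "\<lambda>w. \<beta> * (\<kappa> - l) * exp (- \<kappa> * w) - l * \<beta> * \<kappa> * w"
  \<comment> \<open>Integrating exp ((\<kappa> - l) t) brings a denominator \<kappa> - l, which
    cancels against the same factor in \<open>?\<phi>\<close>; so this antiderivative is valid for
    \<kappa> = l too.\<close>
  let ?F = "\<lambda>t. \<beta> * l * exp (- \<kappa> * (v - t) - l * t) + \<beta> * \<kappa> * exp (- l * t) * (l * (v - t) - 1)"
  have "has_bochner_integral (exponential_law l) (\<lambda>t. ?\<phi> (max (v - t) 0))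
      (?F v - ?F 0 + ?\<phi> 0 * exp (- l * v))"
  proof (rule exponential_law_residual)
    fix t
    have e: "exp (- \<kappa> * (v - t) - l * t) = exp (- l * t) * exp (- \<kappa> * (v - t))"
      by (simp add: exp_add[symmetric] algebra_simps)
    show "(?F has_real_derivative l * exp (- l * t) * ?\<phi> (v - t)) (at t)"
      apply (rule derivative_eq_intros refl)+
      unfolding e by (simp add: algebra_simps)
  qed (use l v in \<open>auto intro!: continuous_intros\<close>)
  \<comment> \<open>\<open>?F v\<close> equals - \<beta> (\<kappa> - l) exp (- l v), exactly the
    negative of the tail term, so only \<open>- ?F 0\<close> survives.\<close>
  moreover have "?F v - ?F 0 + ?\<phi> 0 * exp (- l * v) = H v + \<beta> * \<kappa>"
    by (simp add: H_def algebra_simps)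
  ultimately show ?thesis by simp
qed

lemma laplace_service: "has_bochner_integral (exponential_law 1) (\<lambda>u. exp (- \<kappa> * u)) \<alpha>"
proof -
  have "(\<integral>\<^sup>+ u. ennreal (exp (- \<kappa> * u)) \<partial>exponential_law 1) =
      (\<integral>\<^sup>+ u. ennreal (\<alpha> * exponential_density (1 + \<kappa>) u) \<partial>lborel)"
    unfolding exponential_law_def
    by (subst nn_integral_density)
       (use \<kappa> in \<open>auto simp: exponential_density_def \<alpha>_def ennreal_mult'[symmetric] exp_add[symmetric] field_simps intro!: nn_integral_cong\<close>)
  also have "\<dots> = \<alpha>"
    using nn_integral_erlang_ith_moment[of "1 + \<kappa>" 0 0] \<kappa> \<alpha>
    by (simp add: ennreal_mult' nn_integral_cmult)
  finally show ?thesis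
    using \<alpha> by (intro has_bochner_integral_nn_integral) auto
qed

end

lemma has_bochner_integral_pair_mult:
  fixes f :: "'a \<Rightarrow> real" and g :: "'b \<Rightarrow> real"
  assumes "sigma_finite_measure M" "sigma_finite_measure N"
    and f: "has_bochner_integral M f a" and g: "has_bochner_integral N g b"
  shows "has_bochner_integral (M \<Otimes>\<^sub>M N) (\<lambda>(x, y). f x * g y) (a * b)"
proof -
  interpret M: sigma_finite_measure M by fact
  interpret N: sigma_finite_measure N by fact
  interpret pair_sigma_finite M N ..
  have [measurable]: "f \<in> borel_measurable M" "g \<in> borel_measurable N"
    using f g by (auto dest: borel_measurable_has_bochner_integral)
  note fg = f[THEN has_bochner_integral_integral_eq] g[THEN has_bochner_integral_integral_eq]
    integrable.intros[OF f] integrable.intros[OF g]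
  have int: "integrable (M \<Otimes>\<^sub>M N) (\<lambda>(x, y). f x * g y)"
    by (rule Fubini_integrable) (use fg in \<open>auto simp: abs_mult\<close>)
  then show ?thesis
    using integral_fst'[OF int] fg by (simp add: has_bochner_integral_iff)
qed

context mm1
begin

abbreviation "step_law \<equiv> exponential_law l \<Otimes>\<^sub>M exponential_law 1"

lemma prob_space_step_law: "prob_space step_law"
  by (intro prob_space_pair prob_space_exponential_law) (use l in auto)

lemma sets_step_law: "sets step_law = sets (borel \<Otimes>\<^sub>M borel)"
  by (intro sets_pair_measure_cong sets_exponential_law)

lemma borel_measurable_step_law [simp]:
  "borel_measurable step_law = borel_measurable (borel \<Otimes>\<^sub>M borel)"
  by (rule measurable_cong_sets[OF sets_step_law refl])

lemma AE_step_law_nonneg: "AE (t, u) in step_law. 0 \<le> t \<and> 0 \<le> u"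
proof -
  interpret A: prob_space "exponential_law l" using l by (intro prob_space_exponential_law)
  interpret S: prob_space "exponential_law 1" by (intro prob_space_exponential_law) simp
  interpret pair_sigma_finite "exponential_law l" "exponential_law 1" ..
  have *: "{z \<in> space step_law. 0 \<le> fst z \<and> 0 \<le> snd z} \<in> sets step_law"
    unfolding sets_step_law sets_eq_imp_space_eq[OF sets_step_law] by measurable
  have "AE z in step_law. 0 \<le> fst z \<and> 0 \<le> snd z"
    by (rule AE_pair_measure[OF *])
      (use AE_exponential_law_nonneg[OF l(1)] AE_exponential_law_nonneg[of 1] in simp)
  then show ?thesis by (simp add: case_prod_beta)
qed

lemma step_law_prod:
  fixes f g :: "real \<Rightarrow> real"
  shows "has_bochner_integral (exponential_law l) f a \<Longrightarrow> has_bochner_integral (exponential_law 1) g b \<Longrightarrow>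
    has_bochner_integral step_law (\<lambda>(t, u). f t * g u) (a * b)"
  using l by (intro has_bochner_integral_pair_mult prob_space_imp_sigma_finite
      prob_space_exponential_law) auto

lemma step_law_moments:
  "has_bochner_integral step_law (\<lambda>(t, u). 1) (1 :: real)"
  "has_bochner_integral step_law (\<lambda>(t, u). t) (1 / l)"
  "has_bochner_integral step_law (\<lambda>(t, u). u) 1"
  "has_bochner_integral step_law (\<lambda>(t, u). t\<^sup>2) (2 / l\<^sup>2)"
  "has_bochner_integral step_law (\<lambda>(t, u). u\<^sup>2) 2"
proof -
  note m = has_bochner_integral_exponential_moment
  note m = step_law_prod[OF m[OF l(1)] m[OF zero_less_one]]
  show "has_bochner_integral step_law (\<lambda>(t, u). 1) (1 :: real)" using m[of 0 0] by (simp only: power_0 fact_0 div_by_1 mult_1)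
  show "has_bochner_integral step_law (\<lambda>(t, u). t) (1 / l)" using m[of 1 0] by simp
  show "has_bochner_integral step_law (\<lambda>(t, u). u) 1" using m[of 0 1] by simp
  show "has_bochner_integral step_law (\<lambda>(t, u). t\<^sup>2) (2 / l\<^sup>2)" using m[of 2 0] by simp
  show "has_bochner_integral step_law (\<lambda>(t, u). u\<^sup>2) 2" using m[of 0 2] by simp
qed

text \<open>Averaging over u turns exp (- \<kappa> (W + u)) into \<alpha> exp (- \<kappa> W) and
  adds the mean 1 to the linear part of \<open>H\<close>; what is left depends on t only and is
  \<open>poisson_interarrival\<close>. The integrand is decomposed into products of a function of t
  and a function of u for this purpose.\<close>

lemma poisson_equation:
  assumes v: "0 \<le> v"
  shows "has_bochner_integral step_law
    (\<lambda>(t, u). exp (- \<kappa> * max (v - t) 0) - \<rho> + H (max (v - t) 0 + u)) (H v)"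
proof -
  interpret A: prob_space "exponential_law l" using l by (intro prob_space_exponential_law)
  define W where "W t = max (v - t) 0" for t :: real
  \<comment> \<open>The value of this Laplace transform is never computed: it enters with the factor
    l \<beta> \<alpha> through \<open>p\<close> and leaves again with the average of the term in exp
    (- \<kappa> (W + u)).\<close>
  define e where "e = (\<integral>t. exp (- \<kappa> * W t) \<partial>exponential_law l)"
  have e: "has_bochner_integral (exponential_law l) (\<lambda>t. exp (- \<kappa> * W t)) e"
    unfolding e_def has_bochner_integral_iff
    by (intro conjI refl A.integrable_const_bound[of _ 1]) (auto simp: W_def \<kappa> less_imp_le)
  have p: "has_bochner_integral (exponential_law l)
      (\<lambda>t. \<beta> * (\<kappa> - l) * exp (- \<kappa> * W t) - l * \<beta> * \<kappa> * W t - \<rho> + l * \<beta> * \<alpha> * exp (- \<kappa> * W t))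
      (H v + \<beta> * \<kappa> - \<rho> + l * \<beta> * \<alpha> * e)"
    unfolding W_def
    by (intro has_bochner_integral_add has_bochner_integral_diff poisson_interarrival[OF v]
        has_bochner_integral_mult_right e[unfolded W_def]) (use A.prob_space in \<open>auto simp: has_bochner_integral_iff\<close>)
  have one: "has_bochner_integral (exponential_law l') (\<lambda>_. 1 :: real) 1" if "0 < l'" for l'
    using has_bochner_integral_exponential_moment[OF that, of 0] by simp
  have "has_bochner_integral step_law
      (\<lambda>z. (case z of (t, u) \<Rightarrow> (\<beta> * (\<kappa> - l) * exp (- \<kappa> * W t) - l * \<beta> * \<kappa> * W t - \<rho> + l * \<beta> * \<alpha> * exp (- \<kappa> * W t)) * 1)
        - (case z of (t, u) \<Rightarrow> exp (- \<kappa> * W t) * (l * \<beta> * exp (- \<kappa> * u)))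
        - (case z of (t, u) \<Rightarrow> 1 * (l * \<beta> * \<kappa> * u)))
      ((H v + \<beta> * \<kappa> - \<rho> + l * \<beta> * \<alpha> * e) * 1 - e * (l * \<beta> * \<alpha>) - 1 * (l * \<beta> * \<kappa> * 1))"
    using has_bochner_integral_exponential_moment[of 1 1] l
    by (intro has_bochner_integral_diff step_law_prod p e has_bochner_integral_mult_right
        laplace_service one) auto
  also have "(\<lambda>z. (case z of (t, u) \<Rightarrow> (\<beta> * (\<kappa> - l) * exp (- \<kappa> * W t) - l * \<beta> * \<kappa> * W t - \<rho> + l * \<beta> * \<alpha> * exp (- \<kappa> * W t)) * 1)
        - (case z of (t, u) \<Rightarrow> exp (- \<kappa> * W t) * (l * \<beta> * exp (- \<kappa> * u)))
        - (case z of (t, u) \<Rightarrow> 1 * (l * \<beta> * \<kappa> * u)))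
      = (\<lambda>(t, u). exp (- \<kappa> * W t) - \<rho> + H (W t + u))" (is "?L = ?R")
  proof (rule ext)
    fix z :: "real \<times> real"
    obtain t u where z: "z = (t, u)" by force
    have "exp (- \<kappa> * (W t + u)) = exp (- \<kappa> * W t) * exp (- \<kappa> * u)"
      by (simp add: exp_add[symmetric] algebra_simps)
    then show "?L z = ?R z"
      unfolding H_def \<beta>_eq[symmetric] z by (simp add: algebra_simps)
  qed
  also have "(H v + \<beta> * \<kappa> - \<rho> + l * \<beta> * \<alpha> * e) * 1 - e * (l * \<beta> * \<alpha>) - 1 * (l * \<beta> * \<kappa> * 1) = H v"
    by (simp add: \<rho>_eq algebra_simps)
  finally show ?thesis unfolding W_def .
qed

text \<open>The mean of the bound in \<open>step_increment_bound\<close>: 2 / l^2 and 2 are the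
  second moments of the interarrival and service times, and 3 comes from (p + q + r)^2 \<le> 3 (p^2
  + q^2 + r^2).\<close>

definition "var_bound = 3 * ((l * \<beta> * \<kappa>)\<^sup>2 * (2 / l\<^sup>2 + 2) + (l * \<beta> + 1)\<^sup>2)"

lemma var_bound_nonneg: "0 \<le> var_bound" by (simp add: var_bound_def)

text \<open>A step changes the sojourn time by at most t + u, hence the linear part of
  \<open>H\<close> by at most l \<beta> \<kappa> (t + u); the exponential part changes by at most l
  \<beta>, and exp (- \<kappa> W) - \<rho> lies in [-1, 1]. The bound is uniform in v, although
  \<open>H\<close> is unbounded.\<close>

lemma step_increment_bound:
  assumes v: "0 \<le> v" and t: "0 \<le> t" and u: "0 \<le> u"
  shows "(exp (- \<kappa> * max (v - t) 0) - \<rho> + H (max (v - t) 0 + u) - H v)\<^sup>2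
    \<le> 3 * ((l * \<beta> * \<kappa>)\<^sup>2 * (t\<^sup>2 + u\<^sup>2) + (l * \<beta> + 1)\<^sup>2)"
proof -
  define W where "W = max (v - t) 0"
  let ?a = "l * \<beta> * \<kappa>" and ?b = "l * \<beta>"
  let ?y = "exp (- \<kappa> * W) - \<rho> + H (W + u) - H v"
  have pos: "0 \<le> ?a" "0 \<le> ?b" using l \<kappa> \<beta>_pos by auto
  have W: "0 \<le> W" "\<bar>W + u - v\<bar> \<le> t + u" using v t u by (auto simp: W_def)
  have "H (W + u) - H v = - (?a * (W + u - v)) - ?b * (exp (- \<kappa> * (W + u)) - exp (- \<kappa> * v))"
    by (simp add: H_def algebra_simps)
  moreover have "\<bar>?a * (W + u - v)\<bar> \<le> ?a * (t + u)"
    unfolding abs_mult[of ?a] abs_of_nonneg[OF pos(1)] using W(2) pos(1) by (rule mult_left_mono)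
  moreover have "\<bar>exp (- \<kappa> * (W + u)) - exp (- \<kappa> * v)\<bar> \<le> 1"
  proof -
    have "exp (- \<kappa> * x) \<le> 1 \<and> 0 \<le> exp (- \<kappa> * x)" if "0 \<le> x" for x using \<kappa> that by simp
    from this[of "W + u"] this[of v] show ?thesis using W(1) u v by (smt (verit))
  qed
  then have "\<bar>?b * (exp (- \<kappa> * (W + u)) - exp (- \<kappa> * v))\<bar> \<le> ?b"
    unfolding abs_mult[of ?b] abs_of_nonneg[OF pos(2)] using pos(2)
    by (metis mult_left_mono mult.right_neutral)
  moreover have "\<bar>exp (- \<kappa> * W) - \<rho>\<bar> \<le> 1"
  proof -
    have "exp (- \<kappa> * W) \<le> 1" "0 < exp (- \<kappa> * W)" using \<kappa> W by simp_all
    then show ?thesis using \<rho> by linarith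
  qed
  ultimately have "\<bar>?y\<bar> \<le> ?a * t + ?a * u + (?b + 1)"
    by (simp only: distrib_left)
  then have "?y\<^sup>2 \<le> (?a * t + ?a * u + (?b + 1))\<^sup>2"
    by (metis abs_ge_zero power2_abs power_mono)
  also have "\<dots> \<le> 3 * ((?a * t)\<^sup>2 + (?a * u)\<^sup>2 + (?b + 1)\<^sup>2)"
  proof -
    have "(p + q + r)\<^sup>2 \<le> 3 * (p\<^sup>2 + q\<^sup>2 + r\<^sup>2)" for p q r :: real
      using sum_squares_ge_zero[of "p - q" "q - r"] zero_le_square[of "p - r"]
      by (simp add: power2_eq_square algebra_simps)
    then show ?thesis .
  qed
  finally show ?thesis by (simp add: W_def power_mult_distrib algebra_simps)
qed

text \<open>Orthogonality of martingale increments: expand the square around x + H v; the cross term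
  has mean 0 by \<open>poisson_equation\<close>, and \<open>var_bound\<close> covers the squared
  increment. Here x stands for the sum accumulated before the step.\<close>

lemma step_second_moment:
  assumes v: "0 \<le> v"
  shows "(\<integral>\<^sup>+(t, u). ennreal ((x + (exp (- \<kappa> * max (v - t) 0) - \<rho> + H (max (v - t) 0 + u)))\<^sup>2) \<partial>step_law)
    \<le> ennreal ((x + H v)\<^sup>2 + var_bound)" (is "(\<integral>\<^sup>+(t, u). ennreal ((x + ?Y t u)\<^sup>2) \<partial>_) \<le> _")
proof -
  interpret prob_space step_law by (rule prob_space_step_law)
  let ?R = "\<lambda>z. (x + H v)\<^sup>2 + 2 * (x + H v) * ((case z of (t, u) \<Rightarrow> ?Y t u) - H v)
      + 3 * ((l * \<beta> * \<kappa>)\<^sup>2 * ((case z of (t, u) \<Rightarrow> t\<^sup>2) + (case z of (t, u) \<Rightarrow> u\<^sup>2)) + (l * \<beta> + 1)\<^sup>2)"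
  have c: "has_bochner_integral step_law (\<lambda>_. c) c" for c :: real
    by (simp add: has_bochner_integral_iff prob_space)
  have R: "has_bochner_integral step_law ?R ((x + H v)\<^sup>2 + 2 * (x + H v) * (H v - H v) + var_bound)"
    unfolding var_bound_def
    by (intro has_bochner_integral_add has_bochner_integral_mult_right has_bochner_integral_diff
        poisson_equation step_law_moments c v)
  have le: "AE z in step_law. (case z of (t, u) \<Rightarrow> (x + ?Y t u)\<^sup>2) \<le> ?R z"
    using AE_step_law_nonneg
  proof eventually_elim
    case (elim z)
    obtain t u where z: "z = (t, u)" by force
    have "(x + ?Y t u)\<^sup>2 = (x + H v)\<^sup>2 + 2 * (x + H v) * (?Y t u - H v) + (?Y t u - H v)\<^sup>2"
      by (simp add: power2_eq_square algebra_simps)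
    with step_increment_bound[of v t u] elim v show ?case by (simp add: z)
  qed
  have "(\<integral>\<^sup>+(t, u). ennreal ((x + ?Y t u)\<^sup>2) \<partial>step_law) \<le> (\<integral>\<^sup>+z. ennreal (?R z) \<partial>step_law)"
    by (rule nn_integral_mono_AE) (use le in \<open>auto elim!: eventually_mono intro: ennreal_leI\<close>)
  also have "\<dots> = ennreal ((x + H v)\<^sup>2 + var_bound)"
  proof -
    have "AE z in step_law. 0 \<le> ?R z"
      using le by eventually_elim (auto split: prod.splits intro: order_trans[OF zero_le_power2])
    then show ?thesis
      using R by (subst nn_integral_eq_integral) (auto simp: has_bochner_integral_iff)
  qed
  finally show ?thesis .
qed

text \<open>With W = max (v - t) 0, both W^2 \<le> (v - t)^2 and W u \<le> v u, so the terms linear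
  in v have mean at most 2 v (1 - 1 / l). This is not positive because l < 1, and only the second
  moments of t and u remain.\<close>

lemma step_sojourn_second_moment:
  assumes v: "0 \<le> v"
  shows "(\<integral>\<^sup>+(t, u). ennreal ((max (v - t) 0 + u)\<^sup>2) \<partial>step_law) \<le> ennreal (v\<^sup>2 + (2 / l\<^sup>2 + 2))"
proof -
  interpret prob_space step_law by (rule prob_space_step_law)
  let ?R = "\<lambda>z. v\<^sup>2 - 2 * v * (case z of (t, u) \<Rightarrow> t) + (case z of (t, u) \<Rightarrow> t\<^sup>2)
    + 2 * v * (case z of (t, u) \<Rightarrow> u) + (case z of (t, u) \<Rightarrow> u\<^sup>2)"
  have R: "has_bochner_integral step_law ?R (v\<^sup>2 - 2 * v * (1 / l) + 2 / l\<^sup>2 + 2 * v * 1 + 2)"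
    by (intro has_bochner_integral_add has_bochner_integral_mult_right has_bochner_integral_diff
        step_law_moments) (simp add: has_bochner_integral_iff prob_space)
  have le: "AE z in step_law. (case z of (t, u) \<Rightarrow> (max (v - t) 0 + u)\<^sup>2) \<le> ?R z"
    using AE_step_law_nonneg
  proof eventually_elim
    case (elim z)
    obtain t u where z: "z = (t, u)" by force
    define W where "W = max (v - t) 0"
    have "W \<le> v" "0 \<le> W" using elim v by (auto simp: z W_def)
    then have "W * u \<le> v * u" using elim by (auto simp: z intro!: mult_right_mono)
    moreover have "W\<^sup>2 \<le> (v - t)\<^sup>2" by (auto simp: W_def max_def)
    ultimately have "(W + u)\<^sup>2 \<le> (v - t)\<^sup>2 + 2 * (v * u) + u\<^sup>2" by (simp add: power2_sum)
    then show ?case by (simp add: z W_def power2_diff algebra_simps)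
  qed
  have "(\<integral>\<^sup>+(t, u). ennreal ((max (v - t) 0 + u)\<^sup>2) \<partial>step_law) \<le> (\<integral>\<^sup>+z. ennreal (?R z) \<partial>step_law)"
    by (rule nn_integral_mono_AE) (use le in \<open>auto elim!: eventually_mono intro: ennreal_leI\<close>)
  also have "\<dots> = ennreal (v\<^sup>2 - 2 * v * (1 / l) + 2 / l\<^sup>2 + 2 * v * 1 + 2)"
  proof -
    have "AE z in step_law. 0 \<le> ?R z"
      using le by eventually_elim (auto split: prod.splits intro: order_trans[OF zero_le_power2])
    then show ?thesis
      using R by (subst nn_integral_eq_integral) (auto simp: has_bochner_integral_iff)
  qed
  also have "\<dots> \<le> ennreal (v\<^sup>2 + (2 / l\<^sup>2 + 2))"
  proof (rule ennreal_leI)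
    have "v * 1 \<le> v * (1 / l)" using l v by (intro mult_left_mono) auto
    then show "v\<^sup>2 - 2 * v * (1 / l) + 2 / l\<^sup>2 + 2 * v * 1 + 2 \<le> v\<^sup>2 + (2 / l\<^sup>2 + 2)" by linarith
  qed
  finally show ?thesis .
qed

end

section \<open>The recursion over the symbols of a block\<close>

lemma arrival_fun_upd: "j < n \<Longrightarrow> arrival (\<tau>(n := t)) j = arrival \<tau> j"
  unfolding arrival_def by (intro sum.cong) auto

lemma departure_fun_upd: "j < n \<Longrightarrow> departure (\<tau>(n := t)) (s(n := u)) j = departure \<tau> s j"
  by (induction j) (simp_all add: arrival_fun_upd)

lemma waiting_fun_upd: "j < n \<Longrightarrow> waiting (\<tau>(n := t)) (s(n := u)) j = waiting \<tau> s j"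
  by (simp add: waiting_def arrival_fun_upd departure_fun_upd)

text \<open>
  The time that the last of the first \<open>n\<close> symbols spends in the system. The value at \<open>0\<close> makes
  the recursion below hold for the first symbol too.
\<close>

definition sojourn :: "(nat \<Rightarrow> real) \<Rightarrow> (nat \<Rightarrow> real) \<Rightarrow> nat \<Rightarrow> real" where
  "sojourn \<tau> s n = (if n = 0 then 0 else waiting \<tau> s (n - 1) + s (n - 1))"

text \<open>For n = 0 the hypothesis on t is what makes the right side 0: the first symbol meets an
  empty system. From n = 1 on this is the waiting time recursion.\<close>

lemma waiting_fun_upd_last:
  assumes "0 \<le> t"
  shows "waiting (\<tau>(n := t)) (s(n := u)) n = max (sojourn \<tau> s n - t) 0"
proof (cases n)
  case 0
  then show ?thesis using assms by (simp add: waiting_0 sojourn_def)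
next
  case (Suc j)
  have "arrival (\<tau>(Suc j := t)) (Suc j) - arrival (\<tau>(Suc j := t)) j = t"
    by (simp add: arrival_def)
  then show ?thesis
    by (simp add: Suc waiting_Suc waiting_fun_upd sojourn_def)
qed

lemma sojourn_fun_upd_last:
  "0 \<le> t \<Longrightarrow> sojourn (\<tau>(n := t)) (s(n := u)) (Suc n) = max (sojourn \<tau> s n - t) 0 + u"
  by (simp add: sojourn_def waiting_fun_upd_last del: fun_upd_apply) simp

lemma sojourn_nonneg: "(\<And>i. i < n \<Longrightarrow> 0 \<le> s i) \<Longrightarrow> 0 \<le> sojourn \<tau> s n"
  using waiting_nonneg by (auto simp: sojourn_def intro!: add_nonneg_nonneg)

lemma completion_eq: "0 < n \<Longrightarrow> completion n \<tau> s = (\<Sum>i<n. \<tau> i) + sojourn \<tau> s n"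
  by (cases n) (auto simp: completion_def sojourn_def waiting_def arrival_def lessThan_Suc_atMost)

lemma borel_measurable_waiting:
  assumes "j < n"
  shows "(\<lambda>(\<tau>, s). waiting \<tau> s j)
    \<in> borel_measurable (Pi\<^sub>M {..<n} (\<lambda>_. borel) \<Otimes>\<^sub>M Pi\<^sub>M {..<n} (\<lambda>_. borel))"
proof -
  note [measurable] = measurable_arrival[OF assms] measurable_departure[OF assms, unfolded case_prod_beta]
  show ?thesis unfolding waiting_def case_prod_beta by measurable
qed

section \<open>The timing law of a block and integration over its last symbol\<close>

locale timing =
  fixes FA FS :: "real measure"
  assumes FA: "prob_space FA" "sets FA = sets borel"
    and FS: "prob_space FS" "sets FS = sets borel"
begin

abbreviation "T \<equiv> timing_law FA FS"

lemma prob_space_T: "prob_space (T n)"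
  unfolding timing_law_def by (intro prob_space_pair prob_space_PiM FA FS)

lemma measurable_T_cong:
  "measurable (T n) N = measurable (Pi\<^sub>M {..<n} (\<lambda>_. borel) \<Otimes>\<^sub>M Pi\<^sub>M {..<n} (\<lambda>_. borel)) N"
  by (rule measurable_cong_sets[OF sets_timing_law[OF FA(2) FS(2)] refl])

lemma measurable_T_fst: "i < n \<Longrightarrow> (\<lambda>z. fst z i) \<in> borel_measurable (T n)"
  unfolding measurable_T_cong
  by (rule measurable_compose[OF measurable_fst measurable_component_singleton]) simp

lemma measurable_T_snd: "i < n \<Longrightarrow> (\<lambda>z. snd z i) \<in> borel_measurable (T n)"
  unfolding measurable_T_cong
  by (rule measurable_compose[OF measurable_snd measurable_component_singleton]) simp

lemma measurable_T_waiting: "j < n \<Longrightarrow> (\<lambda>z. waiting (fst z) (snd z) j) \<in> borel_measurable (T n)"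
  unfolding measurable_T_cong using borel_measurable_waiting by (simp add: case_prod_beta)

lemma measurable_T_sojourn: "(\<lambda>z. sojourn (fst z) (snd z) n) \<in> borel_measurable (T n)"
  by (cases n) (simp_all add: sojourn_def borel_measurable_add measurable_T_waiting measurable_T_snd)

lemma AE_T:
  assumes "AE t in FA. P t" "AE u in FS. Q u"
  shows "AE z in T n. \<forall>i<n. P (fst z i) \<and> Q (snd z i)"
proof -
  interpret A: prob_space "Pi\<^sub>M {..<n} (\<lambda>_. FA)" by (intro prob_space_PiM FA)
  interpret S: prob_space "Pi\<^sub>M {..<n} (\<lambda>_. FS)" by (intro prob_space_PiM FS)
  have "AE z in T n. P (fst z i)" if "i < n" for i
  proof -
    have "AE \<tau> in distr (T n) (Pi\<^sub>M {..<n} (\<lambda>_. FA)) fst. P (\<tau> i)"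
      unfolding timing_law_def S.distr_pair_fst
      using AE_PiM_component[of "{..<n}" "\<lambda>_. FA" i P] assms FA that by auto
    then show ?thesis
      by (rule AE_distrD[rotated]) (simp add: timing_law_def)
  qed
  moreover have "AE z in T n. Q (snd z i)" if "i < n" for i
  proof -
    have "AE s in Pi\<^sub>M {..<n} (\<lambda>_. FS). Q (s i)"
      using AE_PiM_component[of "{..<n}" "\<lambda>_. FS" i Q] assms FS that by auto
    then obtain N where N: "{s \<in> space (Pi\<^sub>M {..<n} (\<lambda>_. FS)). \<not> Q (s i)} \<subseteq> N"
      "emeasure (Pi\<^sub>M {..<n} (\<lambda>_. FS)) N = 0" "N \<in> sets (Pi\<^sub>M {..<n} (\<lambda>_. FS))"
      by (auto elim!: AE_E)
    show ?thesis unfolding timing_law_def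
    proof (rule AE_I)
      show "space (Pi\<^sub>M {..<n} (\<lambda>_. FA)) \<times> N \<in> sets (Pi\<^sub>M {..<n} (\<lambda>_. FA) \<Otimes>\<^sub>M Pi\<^sub>M {..<n} (\<lambda>_. FS))"
        using N by auto
      show "emeasure (Pi\<^sub>M {..<n} (\<lambda>_. FA) \<Otimes>\<^sub>M Pi\<^sub>M {..<n} (\<lambda>_. FS)) (space (Pi\<^sub>M {..<n} (\<lambda>_. FA)) \<times> N) = 0"
        using N by (subst S.emeasure_pair_measure_Times) auto
    qed (use N in \<open>auto simp: space_pair_measure\<close>)
  qed
  ultimately have "AE z in T n. \<forall>i\<in>{..<n}. P (fst z i) \<and> Q (snd z i)"
    by (subst AE_ball_countable) auto
  then show ?thesis by (simp only: Ball_def lessThan_iff)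
qed

text \<open>The law groups all interarrival times before all service times, while the queue evolves
  by pairs. Splitting the last coordinate off both products and exchanging the last interarrival
  time with the first n service times gives the form suited to induction over symbols.\<close>

lemma nn_integral_T_Suc:
  assumes \<phi>: "\<phi> \<in> borel_measurable (T (Suc n))"
  shows "(\<integral>\<^sup>+z. \<phi> z \<partial>T (Suc n))
    = (\<integral>\<^sup>+z. (\<integral>\<^sup>+(t, u). \<phi> ((fst z)(n := t), (snd z)(n := u)) \<partial>(FA \<Otimes>\<^sub>M FS)) \<partial>T n)"
proof -
  let ?A = "\<lambda>n. Pi\<^sub>M {..<n} (\<lambda>_. FA)" and ?S = "\<lambda>n. Pi\<^sub>M {..<n} (\<lambda>_. FS)"
  interpret FA: prob_space FA by (rule FA)
  interpret FS: prob_space FS by (rule FS)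
  interpret PA: product_sigma_finite "\<lambda>_::nat. FA" by standard
  interpret PS: product_sigma_finite "\<lambda>_::nat. FS" by standard
  interpret A: prob_space "?A n" by (intro prob_space_PiM FA)
  interpret S: prob_space "?S n" by (intro prob_space_PiM FS)
  interpret S': prob_space "?S (Suc n)" by (intro prob_space_PiM FS)
  interpret SA: pair_sigma_finite "?S n" FA ..
  note [measurable] = \<phi>[unfolded timing_law_def]
  have [measurable]: "(\<lambda>(\<tau>, t). \<tau>(n := t)) \<in> ?A n \<Otimes>\<^sub>M FA \<rightarrow>\<^sub>M ?A (Suc n)"
    "(\<lambda>(s, u). s(n := u)) \<in> ?S n \<Otimes>\<^sub>M FS \<rightarrow>\<^sub>M ?S (Suc n)"
    using measurable_add_dim[of n "{..<n}"] by (simp_all add: lessThan_Suc)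
  have "(\<integral>\<^sup>+z. \<phi> z \<partial>T (Suc n)) = (\<integral>\<^sup>+\<tau>. \<integral>\<^sup>+s. \<phi> (\<tau>, s) \<partial>?S (Suc n) \<partial>?A (Suc n))"
    unfolding timing_law_def by (rule S'.nn_integral_fst[symmetric]) measurable
  also have "\<dots> = (\<integral>\<^sup>+\<tau>. \<integral>\<^sup>+t. \<integral>\<^sup>+s. \<phi> (\<tau>(n := t), s) \<partial>?S (Suc n) \<partial>FA \<partial>?A n)"
    unfolding lessThan_Suc by (rule PA.product_nn_integral_insert)
      (simp_all add: lessThan_Suc[symmetric])
  also have "\<dots> = (\<integral>\<^sup>+\<tau>. \<integral>\<^sup>+t. \<integral>\<^sup>+s. \<integral>\<^sup>+u. \<phi> (\<tau>(n := t), s(n := u)) \<partial>FS \<partial>?S n \<partial>FA \<partial>?A n)"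
  proof (intro nn_integral_cong)
    fix \<tau> t assume \<tau>: "\<tau> \<in> space (?A n)" "t \<in> space FA"
    then have "\<tau>(n := t) \<in> space (?A (Suc n))"
      by (auto simp: space_PiM PiE_def extensional_def Pi_def)
    then have [measurable]: "(\<lambda>s. \<phi> (\<tau>(n := t), s)) \<in> borel_measurable (?S (Suc n))" by measurable
    show "(\<integral>\<^sup>+s. \<phi> (\<tau>(n := t), s) \<partial>?S (Suc n)) = (\<integral>\<^sup>+s. \<integral>\<^sup>+u. \<phi> (\<tau>(n := t), s(n := u)) \<partial>FS \<partial>?S n)"
      unfolding lessThan_Suc by (rule PS.product_nn_integral_insert)
        (simp_all add: lessThan_Suc[symmetric])
  qed
  also have "\<dots> = (\<integral>\<^sup>+\<tau>. \<integral>\<^sup>+s. \<integral>\<^sup>+t. \<integral>\<^sup>+u. \<phi> (\<tau>(n := t), s(n := u)) \<partial>FS \<partial>FA \<partial>?S n \<partial>?A n)"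
    by (intro nn_integral_cong SA.Fubini') measurable
  also have "\<dots> = (\<integral>\<^sup>+\<tau>. \<integral>\<^sup>+s. \<integral>\<^sup>+z. \<phi> (\<tau>(n := fst z), s(n := snd z)) \<partial>(FA \<Otimes>\<^sub>M FS) \<partial>?S n \<partial>?A n)"
  proof (intro nn_integral_cong)
    fix \<tau> s assume "\<tau> \<in> space (?A n)" "s \<in> space (?S n)"
    then have "(\<lambda>z. (\<tau>(n := fst z), s(n := snd z))) \<in> FA \<Otimes>\<^sub>M FS \<rightarrow>\<^sub>M ?A (Suc n) \<Otimes>\<^sub>M ?S (Suc n)"
      by (intro measurable_Pair measurable_fun_upd[where J="{..<n}"]) auto
    then have "(\<lambda>z. \<phi> (\<tau>(n := fst z), s(n := snd z))) \<in> borel_measurable (FA \<Otimes>\<^sub>M FS)"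
      by measurable
    from FS.nn_integral_fst[OF this]
    show "(\<integral>\<^sup>+t. \<integral>\<^sup>+u. \<phi> (\<tau>(n := t), s(n := u)) \<partial>FS \<partial>FA)
        = (\<integral>\<^sup>+z. \<phi> (\<tau>(n := fst z), s(n := snd z)) \<partial>(FA \<Otimes>\<^sub>M FS))"
      by simp
  qed
  also have "\<dots> = (\<integral>\<^sup>+z. \<integral>\<^sup>+w. \<phi> ((fst z)(n := fst w), (snd z)(n := snd w)) \<partial>(FA \<Otimes>\<^sub>M FS) \<partial>T n)"
  proof -
    interpret F: prob_space "FA \<Otimes>\<^sub>M FS" by (intro prob_space_pair FA FS)
    have "(\<lambda>x. ((fst (fst x))(n := fst (snd x)), (snd (fst x))(n := snd (snd x))))
        \<in> (?A n \<Otimes>\<^sub>M ?S n) \<Otimes>\<^sub>M (FA \<Otimes>\<^sub>M FS) \<rightarrow>\<^sub>M ?A (Suc n) \<Otimes>\<^sub>M ?S (Suc n)"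
      by (intro measurable_Pair measurable_fun_upd[where J="{..<n}"]) auto
    then have "(\<lambda>x. \<phi> ((fst (fst x))(n := fst (snd x)), (snd (fst x))(n := snd (snd x))))
        \<in> borel_measurable ((?A n \<Otimes>\<^sub>M ?S n) \<Otimes>\<^sub>M (FA \<Otimes>\<^sub>M FS))"
      by measurable
    then have "(\<lambda>z. \<integral>\<^sup>+w. \<phi> ((fst z)(n := fst w), (snd z)(n := snd w)) \<partial>(FA \<Otimes>\<^sub>M FS))
        \<in> borel_measurable (?A n \<Otimes>\<^sub>M ?S n)"
      by (intro F.borel_measurable_nn_integral) (simp add: case_prod_beta')
    from S.nn_integral_fst[OF this] show ?thesis by (simp add: timing_law_def)
  qed
  finally show ?thesis by (simp add: case_prod_beta')
qed

end

section \<open>Second moments in the stable queue\<close>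

context mm1
begin

sublocale timing "exponential_law l" "exponential_law 1"
  by (rule timing.intro) (simp_all add: l prob_space_exponential_law sets_exponential_law)

lemma AE_T_nonneg: "AE z in T n. \<forall>i<n. 0 \<le> fst z i \<and> 0 \<le> snd z i"
  by (rule AE_T[OF AE_exponential_law_nonneg[OF l(1)] AE_exponential_law_nonneg[OF zero_less_one]])

text \<open>The mean number of symbols that are not erased, given the timing.\<close>

definition G :: "nat \<Rightarrow> (nat \<Rightarrow> real) \<times> (nat \<Rightarrow> real) \<Rightarrow> real" where
  "G n z = (\<Sum>j<n. exp (- \<kappa> * waiting (fst z) (snd z) j))"

abbreviation V :: "nat \<Rightarrow> (nat \<Rightarrow> real) \<times> (nat \<Rightarrow> real) \<Rightarrow> real" where
  "V n z \<equiv> sojourn (fst z) (snd z) n"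

lemma measurable_G [measurable]: "G n \<in> borel_measurable (T n)"
proof -
  note [measurable] = measurable_T_waiting
  have "(\<lambda>z. \<Sum>j<n. exp (- \<kappa> * waiting (fst z) (snd z) j)) \<in> borel_measurable (T n)"
    by (rule borel_measurable_sum) measurable
  then show ?thesis by (simp add: G_def[abs_def])
qed

lemma measurable_V [measurable]: "V n \<in> borel_measurable (T n)"
  by (rule measurable_T_sojourn)

lemma measurable_H [measurable]: "H \<in> borel_measurable borel"
  unfolding H_def[abs_def] by measurable

lemma AE_V_nonneg: "AE z in T n. 0 \<le> V n z"
  using AE_T_nonneg by eventually_elim (rule sojourn_nonneg, simp)

lemma G_fun_upd_last:
  "0 \<le> t \<Longrightarrow> G (Suc n) ((fst z)(n := t), (snd z)(n := u)) = G n z + exp (- \<kappa> * max (V n z - t) 0)"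
  by (simp add: G_def waiting_fun_upd waiting_fun_upd_last del: fun_upd_apply)

text \<open>The common induction step of the moment bounds: \<open>step\<close> bounds the
  conditional mean of one step given the past. The recursion holds for nonnegative times only, and
  the null sets where this fails are disposed of here.\<close>

lemma nn_integral_T_Suc_le:
  assumes "\<phi> \<in> borel_measurable (T (Suc n))" "\<psi> \<in> borel_measurable (T n)"
    and upd: "\<And>z t u. 0 \<le> t \<Longrightarrow> 0 \<le> u \<Longrightarrow> \<phi> ((fst z)(n := t), (snd z)(n := u)) = \<theta> z t u"
    and step: "\<And>z. 0 \<le> V n z \<Longrightarrow> (\<integral>\<^sup>+(t, u). \<theta> z t u \<partial>step_law) \<le> \<psi> z + c"
  shows "(\<integral>\<^sup>+z. \<phi> z \<partial>T (Suc n)) \<le> (\<integral>\<^sup>+z. \<psi> z \<partial>T n) + c"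
proof -
  interpret prob_space "T n" by (rule prob_space_T)
  have "(\<integral>\<^sup>+(t, u). \<phi> ((fst z)(n := t), (snd z)(n := u)) \<partial>step_law) = (\<integral>\<^sup>+(t, u). \<theta> z t u \<partial>step_law)" for z
    by (rule nn_integral_cong_AE) (use AE_step_law_nonneg in eventually_elim, auto simp: upd)
  then have "(\<integral>\<^sup>+z. \<phi> z \<partial>T (Suc n)) = (\<integral>\<^sup>+z. \<integral>\<^sup>+(t, u). \<theta> z t u \<partial>step_law \<partial>T n)"
    by (simp add: nn_integral_T_Suc[OF assms(1)])
  also have "\<dots> \<le> (\<integral>\<^sup>+z. \<psi> z + c \<partial>T n)"
    by (rule nn_integral_mono_AE) (use AE_V_nonneg in eventually_elim, rule step)
  also have "\<dots> = (\<integral>\<^sup>+z. \<psi> z \<partial>T n) + c"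
    using assms(2) by (simp add: nn_integral_add emeasure_space_1)
  finally show ?thesis .
qed

text \<open>
  By \<open>poisson_equation\<close>, \<open>G n - n \<rho> + H (V n)\<close> is a martingale; its increments are
  square-integrable uniformly in \<open>n\<close>.
\<close>

lemma martingale_second_moment:
  "(\<integral>\<^sup>+z. ennreal ((G n z - real n * \<rho> + H (V n z))\<^sup>2) \<partial>T n) \<le> ennreal ((H 0)\<^sup>2 + real n * var_bound)"
proof (induction n)
  case 0
  interpret prob_space "T 0" by (rule prob_space_T)
  show ?case by (simp add: G_def sojourn_def emeasure_space_1)
next
  case (Suc n)
  have "(\<integral>\<^sup>+z. ennreal ((G (Suc n) z - real (Suc n) * \<rho> + H (V (Suc n) z))\<^sup>2) \<partial>T (Suc n))
      \<le> (\<integral>\<^sup>+z. ennreal ((G n z - real n * \<rho> + H (V n z))\<^sup>2) \<partial>T n) + ennreal var_bound"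
  proof (rule nn_integral_T_Suc_le)
    fix z and t u :: real assume "0 \<le> t" "0 \<le> u"
    have e: "G n z + e - real (Suc n) * \<rho> + h = (G n z - real n * \<rho>) + (e - \<rho> + h)" for e h
      by (simp add: algebra_simps)
    show "ennreal ((G (Suc n) ((fst z)(n := t), (snd z)(n := u)) - real (Suc n) * \<rho>
          + H (V (Suc n) ((fst z)(n := t), (snd z)(n := u))))\<^sup>2)
        = ennreal (((G n z - real n * \<rho>)
          + (exp (- \<kappa> * max (V n z - t) 0) - \<rho> + H (max (V n z - t) 0 + u)))\<^sup>2)"
      unfolding G_fun_upd_last[OF \<open>0 \<le> t\<close>] fst_conv snd_conv sojourn_fun_upd_last[OF \<open>0 \<le> t\<close>] e ..
  next
    fix z assume "0 \<le> V n z"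
    from step_second_moment[OF this, of "G n z - real n * \<rho>"] var_bound_nonneg
    show "(\<integral>\<^sup>+(t, u). ennreal (((G n z - real n * \<rho>)
          + (exp (- \<kappa> * max (V n z - t) 0) - \<rho> + H (max (V n z - t) 0 + u)))\<^sup>2) \<partial>step_law)
        \<le> ennreal ((G n z - real n * \<rho> + H (V n z))\<^sup>2) + ennreal var_bound"
      by (simp add: ennreal_plus)
  qed measurable
  also have "\<dots> \<le> ennreal ((H 0)\<^sup>2 + real n * var_bound) + ennreal var_bound"
    by (intro add_right_mono Suc.IH)
  also have "\<dots> = ennreal ((H 0)\<^sup>2 + real (Suc n) * var_bound)"
    using var_bound_nonneg by (simp add: ennreal_plus[symmetric] algebra_simps del: ennreal_plus)
  finally show ?case .
qed

text \<open>Linear growth, one constant per step from \<open>step_sojourn_second_moment\<close>,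
  suffices: it enters the deviation of \<open>G\<close> next to a martingale of the same order, and
  the mean block time as a term of order sqrt n.\<close>

lemma sojourn_second_moment:
  "(\<integral>\<^sup>+z. ennreal ((V n z)\<^sup>2) \<partial>T n) \<le> ennreal (real n * (2 / l\<^sup>2 + 2))"
proof (induction n)
  case 0
  show ?case by (simp add: sojourn_def)
next
  case (Suc n)
  have "(\<integral>\<^sup>+z. ennreal ((V (Suc n) z)\<^sup>2) \<partial>T (Suc n))
      \<le> (\<integral>\<^sup>+z. ennreal ((V n z)\<^sup>2) \<partial>T n) + ennreal (2 / l\<^sup>2 + 2)"
  proof (rule nn_integral_T_Suc_le)
    fix z and t u :: real assume "0 \<le> t" "0 \<le> u"
    show "ennreal ((V (Suc n) ((fst z)(n := t), (snd z)(n := u)))\<^sup>2) = ennreal ((max (V n z - t) 0 + u)\<^sup>2)"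
      unfolding fst_conv snd_conv sojourn_fun_upd_last[OF \<open>0 \<le> t\<close>] ..
  next
    fix z assume "0 \<le> V n z"
    from step_sojourn_second_moment[OF this]
    show "(\<integral>\<^sup>+(t, u). ennreal ((max (V n z - t) 0 + u)\<^sup>2) \<partial>step_law)
        \<le> ennreal ((V n z)\<^sup>2) + ennreal (2 / l\<^sup>2 + 2)"
      by (simp add: ennreal_plus[symmetric] del: ennreal_plus)
  qed measurable
  also have "\<dots> \<le> ennreal (real n * (2 / l\<^sup>2 + 2)) + ennreal (2 / l\<^sup>2 + 2)"
    by (intro add_right_mono Suc.IH)
  also have "\<dots> = ennreal (real (Suc n) * (2 / l\<^sup>2 + 2))"
    by (simp add: ennreal_plus[symmetric] distrib_right del: ennreal_plus)
  finally show ?case .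
qed

text \<open>From (x - y)^2 \<le> 2 x^2 + 2 y^2 with x the martingale and y = H v, and from H v^2
  \<le> (l \<beta>)^2 (2 \<kappa>^2 v^2 + 2), where the mean of v^2 is at most n (2 / l^2 +
  2).\<close>

definition "dev_bound = 2 * ((H 0)\<^sup>2 + var_bound) + 4 * (l * \<beta>)\<^sup>2 * (\<kappa>\<^sup>2 * (2 / l\<^sup>2 + 2) + 1)"

lemma dev_bound_nonneg: "0 \<le> dev_bound"
  using var_bound_nonneg by (simp add: dev_bound_def)

lemma G_second_moment:
  assumes n: "0 < n"
  shows "(\<integral>\<^sup>+z. ennreal ((G n z - real n * \<rho>)\<^sup>2) \<partial>T n) \<le> ennreal (real n * dev_bound)"
proof -
  interpret prob_space "T n" by (rule prob_space_T)
  let ?M = "\<lambda>z. (G n z - real n * \<rho> + H (V n z))\<^sup>2"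
  let ?c = "4 * (l * \<beta>)\<^sup>2"
  have le: "(x - y)\<^sup>2 \<le> 2 * x\<^sup>2 + 2 * y\<^sup>2" for x y :: real
    using zero_le_power2[of "x + y"] by (simp add: power2_eq_square algebra_simps)
  have "(\<integral>\<^sup>+z. ennreal ((G n z - real n * \<rho>)\<^sup>2) \<partial>T n)
      \<le> (\<integral>\<^sup>+z. 2 * ennreal (?M z) + (ennreal (?c * \<kappa>\<^sup>2) * ennreal ((V n z)\<^sup>2) + ennreal ?c) \<partial>T n)"
  proof (rule nn_integral_mono_AE)
    show "AE z in T n. ennreal ((G n z - real n * \<rho>)\<^sup>2)
        \<le> 2 * ennreal (?M z) + (ennreal (?c * \<kappa>\<^sup>2) * ennreal ((V n z)\<^sup>2) + ennreal ?c)"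
      using AE_V_nonneg
    proof eventually_elim
      case (elim z)
      define v where "v = V n z"
      have v: "0 \<le> v" using elim by (simp add: v_def)
      have "(\<kappa> * v + exp (- \<kappa> * v))\<^sup>2 \<le> (\<kappa> * v + 1)\<^sup>2"
        using v \<kappa> by (intro power_mono add_left_mono) auto
      also have "\<dots> \<le> 2 * (\<kappa>\<^sup>2 * v\<^sup>2) + 2"
        using le[of "\<kappa> * v" "-1"] by (simp add: power_mult_distrib)
      finally have "(l * \<beta>)\<^sup>2 * (\<kappa> * v + exp (- \<kappa> * v))\<^sup>2 \<le> (l * \<beta>)\<^sup>2 * (2 * (\<kappa>\<^sup>2 * v\<^sup>2) + 2)"
        by (rule mult_left_mono) simp
      moreover have "(H v)\<^sup>2 = (l * \<beta>)\<^sup>2 * (\<kappa> * v + exp (- \<kappa> * v))\<^sup>2"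
        by (simp add: H_def power_mult_distrib)
      ultimately have "2 * (H v)\<^sup>2 \<le> ?c * \<kappa>\<^sup>2 * v\<^sup>2 + ?c"
        by (simp add: algebra_simps)
      moreover have "(G n z - real n * \<rho>)\<^sup>2 \<le> 2 * ?M z + 2 * (H v)\<^sup>2"
        using le[of "G n z - real n * \<rho> + H v" "H v"] by (simp add: v_def)
      ultimately have "(G n z - real n * \<rho>)\<^sup>2 \<le> 2 * ?M z + (?c * \<kappa>\<^sup>2 * (V n z)\<^sup>2 + ?c)"
        by (simp add: v_def)
      from ennreal_leI[OF this] show ?case
        by (simp add: ennreal_plus ennreal_mult')
    qed
  qed
  also have "\<dots> = 2 * (\<integral>\<^sup>+z. ennreal (?M z) \<partial>T n)
      + (ennreal (?c * \<kappa>\<^sup>2) * (\<integral>\<^sup>+z. ennreal ((V n z)\<^sup>2) \<partial>T n) + ennreal ?c)"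
    by (simp add: nn_integral_add nn_integral_cmult emeasure_space_1)
  also have "\<dots> \<le> 2 * ennreal ((H 0)\<^sup>2 + real n * var_bound)
      + (ennreal (?c * \<kappa>\<^sup>2) * ennreal (real n * (2 / l\<^sup>2 + 2)) + ennreal ?c)"
    by (intro add_mono mult_left_mono martingale_second_moment sojourn_second_moment order_refl zero_le)
  also have "\<dots> = ennreal (2 * ((H 0)\<^sup>2 + real n * var_bound)
      + (?c * \<kappa>\<^sup>2 * (real n * (2 / l\<^sup>2 + 2)) + ?c))"
    using var_bound_nonneg by (simp add: ennreal_plus ennreal_mult')
  also have "\<dots> \<le> ennreal (real n * dev_bound)"
  proof (rule ennreal_leI)
    \<comment> \<open>The contributions that do not grow with n are absorbed by the factor n \<ge>
      1.\<close>
    have "1 * (2 * (H 0)\<^sup>2 + ?c) \<le> real n * (2 * (H 0)\<^sup>2 + ?c)"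
      using n by (intro mult_right_mono) auto
    then show "2 * ((H 0)\<^sup>2 + real n * var_bound) + (?c * \<kappa>\<^sup>2 * (real n * (2 / l\<^sup>2 + 2)) + ?c)
        \<le> real n * dev_bound"
      unfolding dev_bound_def using l by (simp add: algebra_simps)
  qed
  finally show ?thesis .
qed

lemma interarrival_sum_mean: "(\<integral>\<^sup>+z. ennreal (\<Sum>i<n. fst z i) \<partial>T n) = ennreal (real n / l)"
proof (induction n)
  case 0
  show ?case by simp
next
  case (Suc n)
  interpret prob_space "T n" by (rule prob_space_T)
  interpret step: prob_space step_law by (rule prob_space_step_law)
  note [measurable] = measurable_T_fst
  have [measurable]: "(\<lambda>z. \<Sum>i<k. fst z i) \<in> borel_measurable (T k)" for k
    by (rule borel_measurable_sum) measurable
  have t: "(\<integral>\<^sup>+z. ennreal (fst z) \<partial>step_law) = ennreal (1 / l)"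
    using AE_step_law_nonneg step_law_moments(2)
    by (subst nn_integral_eq_integral) (auto simp: has_bochner_integral_iff case_prod_beta')
  have "(\<integral>\<^sup>+z. ennreal (\<Sum>i<Suc n. fst z i) \<partial>T (Suc n))
      = (\<integral>\<^sup>+z. \<integral>\<^sup>+w. ennreal ((\<Sum>i<n. fst z i) + fst w) \<partial>step_law \<partial>T n)"
    by (subst nn_integral_T_Suc) (auto simp: case_prod_beta' intro!: nn_integral_cong)
  also have "\<dots> = (\<integral>\<^sup>+z. ennreal (\<Sum>i<n. fst z i) + ennreal (1 / l) \<partial>T n)"
  proof (rule nn_integral_cong_AE)
    show "AE z in T n. (\<integral>\<^sup>+w. ennreal ((\<Sum>i<n. fst z i) + fst w) \<partial>step_law)
        = ennreal (\<Sum>i<n. fst z i) + ennreal (1 / l)"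
      using AE_T_nonneg
    proof eventually_elim
      case (elim z)
      then have s: "0 \<le> (\<Sum>i<n. fst z i)" by (intro sum_nonneg) auto
      have "(\<integral>\<^sup>+w. ennreal ((\<Sum>i<n. fst z i) + fst w) \<partial>step_law)
          = (\<integral>\<^sup>+w. ennreal (\<Sum>i<n. fst z i) + ennreal (fst w) \<partial>step_law)"
        by (rule nn_integral_cong_AE) (use AE_step_law_nonneg in eventually_elim, auto simp: s ennreal_plus)
      also have "\<dots> = ennreal (\<Sum>i<n. fst z i) + ennreal (1 / l)"
        by (subst nn_integral_add) (auto simp: t step.emeasure_space_1)
      finally show ?case .
    qed
  qed
  also have "\<dots> = ennreal (real n / l) + ennreal (1 / l)"
    by (subst nn_integral_add) (auto simp: Suc.IH emeasure_space_1)
  also have "\<dots> = ennreal (real (Suc n) / l)"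
    using l by (simp add: ennreal_plus[symmetric] add_divide_distrib del: ennreal_plus)
  finally show ?case .
qed

text \<open>The last arrival has mean time n / l, which gives the lower bound since a sojourn time
  is nonnegative. For the upper bound its mean must be o(n), and the linear second moment yields
  order sqrt n.\<close>

lemma completion_mean:
  assumes n: "0 < n"
  shows "ennreal (real n / l) \<le> (\<integral>\<^sup>+(\<tau>, s). ennreal (completion n \<tau> s) \<partial>T n)"
    and "(\<integral>\<^sup>+(\<tau>, s). ennreal (completion n \<tau> s) \<partial>T n) \<le> ennreal (real n / l + sqrt (real n) * (2 / l\<^sup>2 + 3))"
proof -
  interpret prob_space "T n" by (rule prob_space_T)
  note [measurable] = measurable_T_fst
  have [measurable]: "(\<lambda>z. \<Sum>i<n. fst z i) \<in> borel_measurable (T n)"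
    by (rule borel_measurable_sum) measurable
  have eq: "(\<integral>\<^sup>+(\<tau>, s). ennreal (completion n \<tau> s) \<partial>T n)
      = (\<integral>\<^sup>+z. ennreal (\<Sum>i<n. fst z i) + ennreal (V n z) \<partial>T n)"
  proof (rule nn_integral_cong_AE)
    show "AE z in T n. (case z of (\<tau>, s) \<Rightarrow> ennreal (completion n \<tau> s))
        = ennreal (\<Sum>i<n. fst z i) + ennreal (V n z)"
      using AE_V_nonneg AE_T_nonneg
      by eventually_elim (auto simp: completion_eq[OF n] case_prod_beta intro!: ennreal_plus sum_nonneg)
  qed
  also have sum: "\<dots> = ennreal (real n / l) + (\<integral>\<^sup>+z. ennreal (V n z) \<partial>T n)"
    by (simp add: nn_integral_add interarrival_sum_mean)
  finally show "ennreal (real n / l) \<le> (\<integral>\<^sup>+(\<tau>, s). ennreal (completion n \<tau> s) \<partial>T n)"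
    by simp
  let ?r = "sqrt (real n)"
  have r: "0 < ?r" using n by simp
  have "(\<integral>\<^sup>+z. ennreal (V n z) \<partial>T n) \<le> (\<integral>\<^sup>+z. ennreal ?r + ennreal (1 / ?r) * ennreal ((V n z)\<^sup>2) \<partial>T n)"
  proof (rule nn_integral_mono)
    fix z
    \<comment> \<open>The weight sqrt n balances the two terms of V \<le> r + V^2 / r: both have
      mean of order sqrt n.\<close>
    have "V n z * ?r \<le> ?r\<^sup>2 + (V n z)\<^sup>2"
      using zero_le_power2[of "V n z - ?r"] zero_le_power2[of "V n z"] zero_le_power2[of ?r]
      unfolding power2_diff by linarith
    then have "V n z \<le> ?r + 1 / ?r * (V n z)\<^sup>2"
      using r by (simp add: field_simps power2_eq_square)
    moreover have "ennreal (1 / ?r * (V n z)\<^sup>2) = ennreal (1 / ?r) * ennreal ((V n z)\<^sup>2)"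
      by (rule ennreal_mult') simp
    ultimately show "ennreal (V n z) \<le> ennreal ?r + ennreal (1 / ?r) * ennreal ((V n z)\<^sup>2)"
      using r by (metis ennreal_leI ennreal_plus less_imp_le zero_le_divide_1_iff zero_le_mult_iff zero_le_power2)
  qed
  also have "\<dots> = ennreal ?r + ennreal (1 / ?r) * (\<integral>\<^sup>+z. ennreal ((V n z)\<^sup>2) \<partial>T n)"
    by (simp add: nn_integral_add nn_integral_cmult emeasure_space_1)
  also have "\<dots> \<le> ennreal ?r + ennreal (1 / ?r) * ennreal (real n * (2 / l\<^sup>2 + 2))"
    by (intro add_left_mono mult_left_mono sojourn_second_moment) simp
  also have "\<dots> = ennreal (?r * (2 / l\<^sup>2 + 3))"
  proof -
    have "1 / ?r * (real n * (2 / l\<^sup>2 + 2)) = ?r * (2 / l\<^sup>2 + 2)"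
      using real_div_sqrt[of "real n"] by (metis mult_1 of_nat_0_le_iff times_divide_eq_left)
    moreover have "ennreal (1 / ?r) * ennreal (real n * (2 / l\<^sup>2 + 2)) = ennreal (1 / ?r * (real n * (2 / l\<^sup>2 + 2)))"
      by (rule ennreal_mult'[symmetric]) simp
    moreover have "ennreal ?r + ennreal (?r * (2 / l\<^sup>2 + 2)) = ennreal (?r + ?r * (2 / l\<^sup>2 + 2))"
      using r by (intro ennreal_plus[symmetric]) auto
    moreover have "?r + ?r * (2 / l\<^sup>2 + 2) = ?r * (2 / l\<^sup>2 + 3)" by (simp add: algebra_simps)
    ultimately show ?thesis by (simp only:)
  qed
  finally have "(\<integral>\<^sup>+z. ennreal (V n z) \<partial>T n) \<le> ennreal (?r * (2 / l\<^sup>2 + 3))" .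
  then have "ennreal (real n / l) + (\<integral>\<^sup>+z. ennreal (V n z) \<partial>T n)
      \<le> ennreal (real n / l) + ennreal (?r * (2 / l\<^sup>2 + 3))"
    by (rule add_left_mono)
  also have "\<dots> = ennreal (real n / l + ?r * (2 / l\<^sup>2 + 3))"
    using l by (simp add: ennreal_plus)
  finally show "(\<integral>\<^sup>+(\<tau>, s). ennreal (completion n \<tau> s) \<partial>T n)
      \<le> ennreal (real n / l + sqrt (real n) * (2 / l\<^sup>2 + 3))"
    unfolding eq sum .
qed

end

section \<open>Erasure patterns and random codebooks\<close>

text \<open>A pattern is the set of the positions that are not erased.\<close>

definition pattern_prob :: "(nat \<Rightarrow> real) \<Rightarrow> nat \<Rightarrow> nat set \<Rightarrow> real" where
  "pattern_prob q n S = (\<Prod>j\<in>S. 1 - q j) * (\<Prod>j\<in>{..<n} - S. q j)"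

definition observe :: "nat \<Rightarrow> nat set \<Rightarrow> (nat \<Rightarrow> 'x) \<Rightarrow> nat \<Rightarrow> 'x option" where
  "observe n S x = restrict (\<lambda>j. if j \<in> S then Some (x j) else None) {..<n}"

lemma pattern_prob_nonneg:
  "S \<subseteq> {..<n} \<Longrightarrow> (\<And>j. j < n \<Longrightarrow> 0 \<le> q j \<and> q j \<le> 1) \<Longrightarrow> 0 \<le> pattern_prob q n S"
  unfolding pattern_prob_def by (intro mult_nonneg_nonneg prod_nonneg) auto

lemma sum_pattern_prob: "(\<Sum>S\<in>Pow {..<n}. pattern_prob q n S) = 1"
  unfolding pattern_prob_def by (subst prod_add[symmetric]) auto

lemma sum_pattern_prob_Suc:
  "(\<Sum>S\<in>Pow {..<Suc n}. pattern_prob q (Suc n) S * \<phi> S)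
    = (\<Sum>S\<in>Pow {..<n}. pattern_prob q n S * (q n * \<phi> S + (1 - q n) * \<phi> (insert n S)))"
proof -
  have 1: "pattern_prob q (Suc n) S = pattern_prob q n S * q n" if "S \<subseteq> {..<n}" for S
  proof -
    have "{..<Suc n} - S = insert n ({..<n} - S)" using that by auto
    then show ?thesis by (simp add: pattern_prob_def)
  qed
  have 2: "pattern_prob q (Suc n) (insert n S) = pattern_prob q n S * (1 - q n)" if "S \<subseteq> {..<n}" for S
  proof -
    have "{..<Suc n} - insert n S = {..<n} - S" "n \<notin> S" "finite S"
      using that finite_subset[OF that] by auto
    then show ?thesis by (simp add: pattern_prob_def)
  qed
  have "Pow {..<Suc n} = Pow {..<n} \<union> insert n ` Pow {..<n}"
    by (simp add: lessThan_Suc Pow_insert)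
  moreover have "Pow {..<n} \<inter> insert n ` Pow {..<n} = {}" by auto
  moreover have "inj_on (insert n) (Pow {..<n})" by (auto simp: inj_on_def)
  ultimately have "(\<Sum>S\<in>Pow {..<Suc n}. pattern_prob q (Suc n) S * \<phi> S)
      = (\<Sum>S\<in>Pow {..<n}. pattern_prob q (Suc n) S * \<phi> S)
        + (\<Sum>S\<in>Pow {..<n}. pattern_prob q (Suc n) (insert n S) * \<phi> (insert n S))"
    by (simp add: sum.union_disjoint sum.reindex)
  also have "\<dots> = (\<Sum>S\<in>Pow {..<n}. pattern_prob q n S * (q n * \<phi> S + (1 - q n) * \<phi> (insert n S)))"
    unfolding sum.distrib[symmetric] by (rule sum.cong) (simp_all add: 1 2 distrib_left mult.assoc)
  finally show ?thesis .
qed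

text \<open>Squared bias plus variance for a sum of independent indicators with success
  probabilities 1 - q j. The centre c is arbitrary in the induction because averaging over the last
  symbol recentres the square at c - (1 - q n).\<close>

lemma pattern_card_second_moment:
  "(\<Sum>S\<in>Pow {..<n}. pattern_prob q n S * (real (card S) - c)\<^sup>2)
    = ((\<Sum>j<n. 1 - q j) - c)\<^sup>2 + (\<Sum>j<n. q j * (1 - q j))"
proof (induction n arbitrary: c)
  case 0
  show ?case by (simp add: pattern_prob_def)
next
  case (Suc n)
  have "(\<Sum>S\<in>Pow {..<Suc n}. pattern_prob q (Suc n) S * (real (card S) - c)\<^sup>2)
    = (\<Sum>S\<in>Pow {..<n}. pattern_prob q n S * (real (card S) - (c - (1 - q n)))\<^sup>2 + pattern_prob q n S * (q n * (1 - q n)))"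
    unfolding sum_pattern_prob_Suc
  proof (rule sum.cong)
    fix S assume "S \<in> Pow {..<n}"
    then have "card (insert n S) = Suc (card S)"
      using finite_subset[of S "{..<n}"] by (subst card_insert_disjoint) auto
    then show "pattern_prob q n S * (q n * (real (card S) - c)\<^sup>2 + (1 - q n) * (real (card (insert n S)) - c)\<^sup>2)
      = pattern_prob q n S * (real (card S) - (c - (1 - q n)))\<^sup>2 + pattern_prob q n S * (q n * (1 - q n))"
      by (simp add: power2_eq_square algebra_simps)
  qed simp
  also have "\<dots> = ((\<Sum>j<n. 1 - q j) - (c - (1 - q n)))\<^sup>2 + (\<Sum>j<n. q j * (1 - q j)) + q n * (1 - q n)"
    by (simp add: sum.distrib Suc.IH sum_distrib_right[symmetric] sum_pattern_prob)
  finally show ?case by (simp add: algebra_simps)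
qed

lemma emeasure_erase:
  assumes "0 \<le> q" "q \<le> 1"
  shows "emeasure (measure_pmf (erase q x)) A
    = ennreal (1 - q) * indicator A (Some x) + ennreal q * indicator A None"
proof -
  have "emeasure (measure_pmf (erase q x)) A = (\<integral>\<^sup>+y. indicator A y \<partial>measure_pmf (erase q x))"
    by simp
  also have "\<dots> = indicator A None * ennreal q + indicator A (Some x) * ennreal (1 - q)"
    using assms unfolding erase_def by (simp del: nn_integral_indicator)
  finally show ?thesis by (simp only: mult.commute add.commute)
qed

text \<open>On a box the product of sums of two point masses expands into a sum over subsets, one
  term for each choice of the surviving positions. So the product measure agrees on boxes, hence
  everywhere, with \<open>?D\<close>, the image of the pattern distribution under
  \<open>observe\<close>.\<close>

lemma emeasure_PiM_erase:
  fixes x :: "nat \<Rightarrow> 'x"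
  assumes q: "\<And>j. j < n \<Longrightarrow> 0 \<le> q j \<and> q j \<le> 1" and B: "B \<in> sets (output_space n)"
  shows "emeasure (Pi\<^sub>M {..<n} (\<lambda>j. measure_pmf (erase (q j) (x j)))) B
    = (\<Sum>S\<in>Pow {..<n}. ennreal (pattern_prob q n S) * indicator B (observe n S x))"
proof -
  let ?E = "\<lambda>j. measure_pmf (erase (q j) (x j))"
  let ?P = "point_measure (Pow {..<n}) (\<lambda>S. ennreal (pattern_prob q n S))"
  let ?D = "distr ?P (output_space n) (\<lambda>S. observe n S x)"
  interpret product_sigma_finite ?E by unfold_locales
  have meas: "(\<lambda>S. observe n S x) \<in> ?P \<rightarrow>\<^sub>M output_space n"
    by (auto simp: measurable_def space_point_measure sets_point_measure output_space_def space_PiM observe_def)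
  have D: "emeasure ?D C = (\<Sum>S\<in>Pow {..<n}. ennreal (pattern_prob q n S) * indicator C (observe n S x))"
    if "C \<in> sets (output_space n)" for C
  proof -
    have "emeasure ?D C = (\<integral>\<^sup>+S. indicator C (observe n S x) \<partial>?P)"
    proof -
      have "emeasure ?D C = (\<integral>\<^sup>+y. indicator C y \<partial>?D)"
        using that by (intro nn_integral_indicator[symmetric]) simp
      also have "\<dots> = (\<integral>\<^sup>+S. indicator C (observe n S x) \<partial>?P)"
        using that by (intro nn_integral_distr[OF meas]) simp
      finally show ?thesis .
    qed
    then show ?thesis by (simp add: nn_integral_point_measure_finite mult.commute)
  qed
  have "?D = Pi\<^sub>M {..<n} ?E"
  proof (rule PiM_eqI)
    show "sets ?D = sets (Pi\<^sub>M {..<n} ?E)"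
      by (auto simp: output_space_def intro!: sets_PiM_cong)
    fix A assume "\<And>i. i \<in> {..<n} \<Longrightarrow> A i \<in> sets (?E i)"
    have box: "Pi\<^sub>E {..<n} A \<in> sets (output_space n)"
      unfolding output_space_def by (rule sets_PiM_I_finite) auto
    let ?f = "\<lambda>j. ennreal (1 - q j) * indicator (A j) (Some (x j))"
    let ?g = "\<lambda>j. ennreal (q j) * indicator (A j) None"
    have "(\<Prod>j\<in>{..<n}. emeasure (?E j) (A j)) = (\<Prod>j\<in>{..<n}. ?f j + ?g j)"
      by (intro prod.cong) (auto simp: emeasure_erase q)
    also have "\<dots> = (\<Sum>S\<in>Pow {..<n}. prod ?f S * prod ?g ({..<n} - S))"
      by (rule prod_add) simp
    also have "\<dots> = (\<Sum>S\<in>Pow {..<n}. ennreal (pattern_prob q n S) * indicator (Pi\<^sub>E {..<n} A) (observe n S x))"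
    proof (rule sum.cong)
      fix S assume S: "S \<in> Pow {..<n}"
      have fS: "finite S" using S finite_subset[of S "{..<n}"] by auto
      have i: "indicator (Pi\<^sub>E {..<n} A) (observe n S x)
          = (\<Prod>j\<in>S. indicator (A j) (Some (x j))) * (\<Prod>j\<in>{..<n} - S. indicator (A j) None :: ennreal)"
      proof (cases "observe n S x \<in> Pi\<^sub>E {..<n} A")
        case True
        then have "\<And>j. j < n \<Longrightarrow> observe n S x j \<in> A j" by auto
        then have "(\<forall>j\<in>S. Some (x j) \<in> A j) \<and> (\<forall>j\<in>{..<n} - S. None \<in> A j)"
          using S by (fastforce simp: observe_def split: if_splits)
        with True show ?thesis by simp
      next
        case False
        then obtain j where "j < n" "observe n S x j \<notin> A j"
          by (auto simp: observe_def PiE_def)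
        then have "(\<exists>j\<in>S. Some (x j) \<notin> A j) \<or> (\<exists>j\<in>{..<n} - S. None \<notin> A j)"
          by (auto simp: observe_def split: if_splits)
        then have "(\<exists>j\<in>S. indicator (A j) (Some (x j)) = (0 :: ennreal))
            \<or> (\<exists>j\<in>{..<n} - S. indicator (A j) None = (0 :: ennreal))"
          by (metis indicator_simps(2))
        then have "(\<Prod>j\<in>S. indicator (A j) (Some (x j))) = (0 :: ennreal)
            \<or> (\<Prod>j\<in>{..<n} - S. indicator (A j) None) = (0 :: ennreal)"
          using fS by (metis prod_zero finite_Diff finite_lessThan)
        then show ?thesis using False by (elim disjE) (simp_all only: indicator_simps(2)[OF False] mult_zero_left mult_zero_right)
      qed
      have "ennreal (pattern_prob q n S) = (\<Prod>j\<in>S. ennreal (1 - q j)) * (\<Prod>j\<in>{..<n} - S. ennreal (q j))"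
      proof -
        have "ennreal (\<Prod>j\<in>S. 1 - q j) = (\<Prod>j\<in>S. ennreal (1 - q j))"
          using S q by (intro prod_ennreal[symmetric]) auto
        moreover have "ennreal (\<Prod>j\<in>{..<n} - S. q j) = (\<Prod>j\<in>{..<n} - S. ennreal (q j))"
          using q by (intro prod_ennreal[symmetric]) auto
        moreover have "0 \<le> (\<Prod>j\<in>S. 1 - q j)" using S q by (intro prod_nonneg) auto
        ultimately show ?thesis by (simp add: pattern_prob_def ennreal_mult')
      qed
      then show "prod ?f S * prod ?g ({..<n} - S)
          = ennreal (pattern_prob q n S) * indicator (Pi\<^sub>E {..<n} A) (observe n S x)"
        unfolding i by (simp add: prod.distrib mult_ac)
    qed simp
    finally show "emeasure ?D (Pi\<^sub>E {..<n} A) = (\<Prod>j\<in>{..<n}. emeasure (?E j) (A j))"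
      using D[OF box] by simp
  qed simp
  with D[OF B] show ?thesis by simp
qed

text \<open>Two words that agree on S produce the same output, for which the decoder names just one
  message. So correctly decoded messages have distinct restrictions to S, whatever the
  decoder.\<close>

lemma card_correct_le:
  fixes f :: "nat \<Rightarrow> nat \<Rightarrow> bool"
  assumes S: "S \<subseteq> {..<n}"
  shows "card {m \<in> MM. g (observe n S (f m)) = m} \<le> 2 ^ card S"
proof -
  let ?C = "{m \<in> MM. g (observe n S (f m)) = m}"
  have fS: "finite S" using S finite_subset[of S "{..<n}"] by auto
  have "inj_on (\<lambda>m. restrict (f m) S) ?C"
  proof (rule inj_onI)
    fix m m' assume *: "m \<in> ?C" "m' \<in> ?C" "restrict (f m) S = restrict (f m') S"
    have "f m j = f m' j" if "j \<in> S" for j using fun_cong[OF *(3), of j] that by simp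
    then have "observe n S (f m) = observe n S (f m')" by (auto simp: observe_def)
    with * show "m = m'" by (metis (mono_tags, lifting) mem_Collect_eq)
  qed
  moreover have "(\<lambda>m. restrict (f m) S) ` ?C \<subseteq> S \<rightarrow>\<^sub>E UNIV" by auto
  ultimately have "card ?C \<le> card (S \<rightarrow>\<^sub>E (UNIV :: bool set))"
    using fS by (intro card_inj_on_le) (auto intro: finite_PiE)
  then show ?thesis by (simp add: card_PiE fS)
qed

section \<open>Random codebooks and the matching decoder\<close>

definition codebooks :: "nat set \<Rightarrow> nat \<Rightarrow> (nat \<Rightarrow> nat \<Rightarrow> bool) set" where
  "codebooks MM n = MM \<rightarrow>\<^sub>E {..<n} \<rightarrow>\<^sub>E UNIV"

lemma finite_codebooks: "finite MM \<Longrightarrow> finite (codebooks MM n)"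
  unfolding codebooks_def by (intro finite_PiE) auto

lemma codebooks_nonempty: "codebooks MM n \<noteq> {}"
  unfolding codebooks_def by (simp add: PiE_eq_empty_iff)

text \<open>
  Adding to the word of \<open>m'\<close> the indicators of the subsets of \<open>S\<close> maps the codebooks with a
  collision on \<open>S\<close> to \<open>2 ^ card S\<close> disjoint sets of the same size.
\<close>

lemma card_collision_le:
  assumes MM: "finite MM" "m' \<in> MM" "m \<noteq> m'" and S: "S \<subseteq> {..<n}"
  shows "card {f \<in> codebooks MM n. observe n S (f m) = observe n S (f m')} * 2 ^ card S
    \<le> card (codebooks MM n)"
proof -
  let ?B = "{f \<in> codebooks MM n. observe n S (f m) = observe n S (f m')}"
  let ?h = "\<lambda>(f, a). f(m' := restrict (\<lambda>j. f m' j \<noteq> (j \<in> a)) {..<n})"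
  have fS: "finite S" using S finite_subset[of S "{..<n}"] by auto
  have "inj_on ?h (?B \<times> Pow S)"
  proof (rule inj_onI)
    fix z z' assume *: "z \<in> ?B \<times> Pow S" "z' \<in> ?B \<times> Pow S" "?h z = ?h z'"
    obtain f a f' a' where z: "z = (f, a)" "z' = (f', a')" by (metis surj_pair)
    have off: "f k = f' k" if "k \<noteq> m'" for k
      using fun_cong[OF *(3), of k] that by (simp add: z)
    have on: "f m' j \<noteq> (j \<in> a) \<longleftrightarrow> f' m' j \<noteq> (j \<in> a')" if "j < n" for j
      using fun_cong[OF fun_cong[OF *(3), of m'], of j] that by (simp add: z)
    \<comment> \<open>On S the original word of m' equals that of m, which \<open>?h\<close> leaves
      alone because m and m' differ. Hence the altered word reveals the added set a, and then the
      original word.\<close>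
    have coll: "g m j = g m' j" if "j \<in> S" "g \<in> ?B" for g j
    proof -
      have "observe n S (g m) j = observe n S (g m') j" using that by simp
      then show ?thesis using that S by (auto simp: observe_def)
    qed
    have fB: "f \<in> ?B" "f' \<in> ?B" and aS: "a \<subseteq> S" "a' \<subseteq> S" using * by (auto simp: z)
    have eqS: "f m' j = f' m' j" if "j \<in> S" for j
      using coll[OF that fB(1)] coll[OF that fB(2)] off[OF MM(3)] by simp
    have "j \<in> a \<longleftrightarrow> j \<in> a'" if "j \<in> S" for j using on[of j] eqS[OF that] that S by auto
    then have a: "a = a'" using aS by blast
    have "f m' = f' m'"
    proof (rule PiE_ext[of _ "{..<n}" "\<lambda>_. UNIV"])
      show "f m' \<in> {..<n} \<rightarrow>\<^sub>E UNIV" "f' m' \<in> {..<n} \<rightarrow>\<^sub>E UNIV"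
        using fB MM(2) by (auto simp: codebooks_def)
      show "f m' j = f' m' j" if "j \<in> {..<n}" for j using on[of j] that a by auto
    qed
    then have "f = f'" using off by (metis ext)
    then show "z = z'" by (simp add: z a)
  qed
  moreover have "?h ` (?B \<times> Pow S) \<subseteq> codebooks MM n"
  proof (rule image_subsetI)
    fix z assume "z \<in> ?B \<times> Pow S"
    then obtain f a where z: "z = (f, a)" and f: "f \<in> MM \<rightarrow>\<^sub>E {..<n} \<rightarrow>\<^sub>E UNIV"
      by (auto simp: codebooks_def)
    have "f(m' := restrict (\<lambda>j. f m' j \<noteq> (j \<in> a)) {..<n}) \<in> insert m' MM \<rightarrow>\<^sub>E {..<n} \<rightarrow>\<^sub>E UNIV"
      by (rule PiE_fun_upd[OF _ f]) auto
    then show "?h z \<in> codebooks MM n" using MM(2) by (simp add: codebooks_def z insert_absorb)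
  qed
  ultimately have "card (?B \<times> Pow S) \<le> card (codebooks MM n)"
    using finite_codebooks[OF MM(1)] by (intro card_inj_on_le)
  then show ?thesis by (simp add: card_cartesian_product card_Pow fS)
qed

text \<open>Any message whose word fits the output. No times are consulted, so the same decoder
  serves both kinds of receiver; the bound on its errors does not depend on how ties are
  broken.\<close>

definition match_decoder :: "nat set \<Rightarrow> nat \<Rightarrow> (nat \<Rightarrow> nat \<Rightarrow> 'x) \<Rightarrow> (nat \<Rightarrow> 'x option) \<Rightarrow> nat" where
  "match_decoder MM n f y = (SOME m. m \<in> MM \<and> (\<exists>S\<subseteq>{..<n}. y = observe n S (f m)))"

text \<open>The sent message always fits, so the choice is never void and an error names another
  message that fits. Its pattern is the true one, as the erased positions can be read off the
  output.\<close>

lemma match_decoder_wrong: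
  assumes "m \<in> MM" "S \<subseteq> {..<n}" "match_decoder MM n f (observe n S (f m)) \<noteq> m"
  shows "\<exists>m'\<in>MM - {m}. observe n S (f m) = observe n S (f m')"
proof -
  define m' where "m' = match_decoder MM n f (observe n S (f m))"
  have "m' \<in> MM \<and> (\<exists>S'\<subseteq>{..<n}. observe n S (f m) = observe n S' (f m'))"
    unfolding m'_def match_decoder_def by (rule someI[of _ m]) (use assms in auto)
  then obtain S' where m': "m' \<in> MM" "S' \<subseteq> {..<n}" "observe n S (f m) = observe n S' (f m')" by auto
  have "j \<in> S \<longleftrightarrow> j \<in> S'" if "j < n" for j
    using fun_cong[OF m'(3), of j] that by (auto simp: observe_def split: if_splits)
  then have "S = S'" using assms(2) m'(2) by blast
  then show ?thesis using m' assms(3) by (auto simp: m'_def)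
qed

text \<open>The union bound over competing messages, with the sums exchanged so that each competitor
  collides in at most a fraction 2^(- card S) of the codebooks. The minimum with 1 keeps the bound
  usable for patterns with few surviving symbols.\<close>

lemma sum_codebook_errors_le:
  assumes MM: "finite MM" "m \<in> MM" and S: "S \<subseteq> {..<n}"
  shows "(\<Sum>f\<in>codebooks MM n. of_bool (match_decoder MM n f (observe n S (f m)) \<noteq> m))
    \<le> real (card (codebooks MM n)) * min 1 (real (card MM) / 2 ^ card S)" (is "?L \<le> _ * min 1 ?b")
proof -
  let ?F = "codebooks MM n"
  note F = finite_codebooks[OF MM(1), of n]
  have "?L \<le> (\<Sum>f\<in>?F. 1)" by (intro sum_mono) auto
  then have 1: "?L \<le> real (card ?F) * 1" by simp
  have "?L \<le> (\<Sum>f\<in>?F. \<Sum>m'\<in>MM - {m}. of_bool (observe n S (f m) = observe n S (f m')))"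
  proof (rule sum_mono)
    fix f
    have n: "0 \<le> (\<Sum>m'\<in>MM - {m}. of_bool (observe n S (f m) = observe n S (f m')) :: real)"
      by (intro sum_nonneg) auto
    show "of_bool (match_decoder MM n f (observe n S (f m)) \<noteq> m)
        \<le> (\<Sum>m'\<in>MM - {m}. of_bool (observe n S (f m) = observe n S (f m')) :: real)"
    proof (cases "match_decoder MM n f (observe n S (f m)) = m")
      case False
      then obtain m' where m': "m' \<in> MM - {m}" "observe n S (f m) = observe n S (f m')"
        using match_decoder_wrong[OF MM(2) S] by blast
      have "of_bool (observe n S (f m) = observe n S (f m'))
          \<le> (\<Sum>m'\<in>MM - {m}. of_bool (observe n S (f m) = observe n S (f m')) :: real)"
        using m' MM by (intro member_le_sum) auto
      with m' False show ?thesis by simp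
    qed (use n in simp)
  qed
  also have "\<dots> = (\<Sum>m'\<in>MM - {m}. \<Sum>f\<in>?F. of_bool (observe n S (f m) = observe n S (f m')))"
    by (rule sum.swap)
  also have "\<dots> \<le> (\<Sum>m'\<in>MM - {m}. real (card ?F) / 2 ^ card S)"
  proof (rule sum_mono)
    fix m' assume "m' \<in> MM - {m}"
    then have "card {f \<in> ?F. observe n S (f m) = observe n S (f m')} * 2 ^ card S \<le> card ?F"
      using MM S by (intro card_collision_le) auto
    then have "real (card {f \<in> ?F. observe n S (f m) = observe n S (f m')}) * 2 ^ card S \<le> real (card ?F)"
      by (drule_tac of_nat_mono[where 'a=real]) (simp only: of_nat_mult of_nat_power of_nat_numeral)
    moreover have "(\<Sum>f\<in>?F. of_bool (observe n S (f m) = observe n S (f m')))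
        = real (card {f \<in> ?F. observe n S (f m) = observe n S (f m')})"
      by (simp add: F Collect_conj_eq)
    ultimately show "(\<Sum>f\<in>?F. of_bool (observe n S (f m) = observe n S (f m'))) \<le> real (card ?F) / 2 ^ card S"
      by (simp add: field_simps)
  qed
  also have "\<dots> = real (card (MM - {m})) * (real (card ?F) / 2 ^ card S)" by simp
  also have "\<dots> \<le> real (card MM) * (real (card ?F) / 2 ^ card S)"
    using MM by (intro mult_right_mono) (auto intro: card_mono)
  finally have "?L \<le> real (card ?F) * ?b" by (simp add: mult.commute)
  with 1 show ?thesis by (simp add: min_def)
qed

text \<open>Chebyshev's inequality before integration. The margin 2 \<eta> is halved: if k exceeds n
  \<rho> by n \<eta>, the square term is already at least 1; otherwise the exponent still falls
  short by n \<eta>. Pointwise in k, it can be averaged over patterns and timing without introducing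
  a deviation event.\<close>

lemma chebyshev_overshoot:
  assumes n: "0 < n" and \<eta>: "0 < \<eta>" and M: "2 powr (real n * (\<rho> + 2 * \<eta>)) \<le> M"
  shows "min 1 (2 ^ k / M) \<le> 2 powr (- real n * \<eta>) + (real k - real n * \<rho>)\<^sup>2 / (real n * \<eta>)\<^sup>2"
proof (cases "real k \<ge> real n * (\<rho> + \<eta>)")
  case True
  then have "(real n * \<eta>)\<^sup>2 \<le> (real k - real n * \<rho>)\<^sup>2"
    using n \<eta> by (intro power_mono) (auto simp: algebra_simps)
  then have "1 \<le> (real k - real n * \<rho>)\<^sup>2 / (real n * \<eta>)\<^sup>2" using n \<eta> by simp
  then show ?thesis by (smt (verit) powr_ge_zero)
next
  case False
  have "2 ^ k / M \<le> 2 powr real k / 2 powr (real n * (\<rho> + 2 * \<eta>))"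
    using M by (simp add: powr_realpow frac_le)
  also have "\<dots> = 2 powr (real k - real n * (\<rho> + 2 * \<eta>))" by (simp add: powr_diff)
  also have "\<dots> \<le> 2 powr (- real n * \<eta>)"
    using False by (intro powr_mono) (auto simp: algebra_simps)
  finally show ?thesis by (smt (verit) zero_le_divide_iff zero_le_power2)
qed

text \<open>The mirror image for coding: here too few surviving symbols are the rare event.\<close>

lemma chebyshev_undershoot:
  assumes n: "0 < n" and \<eta>: "0 < \<eta>" and M: "M \<le> 2 powr (real n * (\<rho> - 2 * \<eta>))"
  shows "min 1 (M / 2 ^ k) \<le> 2 powr (- real n * \<eta>) + (real k - real n * \<rho>)\<^sup>2 / (real n * \<eta>)\<^sup>2"
proof (cases "real k \<le> real n * (\<rho> - \<eta>)")
  case True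
  then have "(real n * \<eta>)\<^sup>2 \<le> (real n * \<rho> - real k)\<^sup>2"
    using n \<eta> by (intro power_mono) (auto simp: algebra_simps)
  then have "1 \<le> (real k - real n * \<rho>)\<^sup>2 / (real n * \<eta>)\<^sup>2"
    using n \<eta> by (simp add: power2_commute)
  then show ?thesis by (smt (verit) powr_ge_zero)
next
  case False
  have "M / 2 ^ k \<le> 2 powr (real n * (\<rho> - 2 * \<eta>)) / 2 powr real k"
    using M by (simp add: powr_realpow divide_right_mono)
  also have "\<dots> = 2 powr (real n * (\<rho> - 2 * \<eta>) - real k)" by (simp add: powr_diff)
  also have "\<dots> \<le> 2 powr (- real n * \<eta>)"
    using False by (intro powr_mono) (auto simp: algebra_simps)
  finally show ?thesis by (smt (verit) zero_le_divide_iff zero_le_power2)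
qed

section \<open>Error probability and capacity\<close>

locale queue_channel = timing +
  fixes p :: "real \<Rightarrow> real"
  assumes p_measurable: "p \<in> borel_measurable borel"
    and p_range: "\<And>w. 0 \<le> w \<Longrightarrow> 0 \<le> p w \<and> p w \<le> 1"
begin

definition pattern :: "nat \<Rightarrow> (nat \<Rightarrow> real) \<times> (nat \<Rightarrow> real) \<Rightarrow> nat set \<Rightarrow> real" where
  "pattern n z S = pattern_prob (\<lambda>j. p (waiting (fst z) (snd z) j)) n S"

definition decoded where
  "decoded n g f z m S = g (observe n S (f m), restrict (arrival (fst z)) {..<n},
    restrict (departure (fst z) (snd z)) {..<n})"

text \<open>The error probability given the timing z. Messages and patterns are finite in number, so
  the timing is all that is left to integrate.\<close>

definition cond_error where
  "cond_error n MM f g z = (\<Sum>m\<in>MM. \<Sum>S\<in>Pow {..<n}.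
    pattern n z S * of_bool (decoded n g f z m S \<noteq> m)) / real (card MM)"

lemma pattern_nonneg: "S \<subseteq> {..<n} \<Longrightarrow> 0 \<le> pattern n z S"
  unfolding pattern_def by (intro pattern_prob_nonneg p_range waiting_nonneg)

lemma sum_pattern: "(\<Sum>S\<in>Pow {..<n}. pattern n z S) = 1"
  by (simp add: pattern_def sum_pattern_prob)

lemma cond_error_nonneg: "0 \<le> cond_error n MM f g z"
  unfolding cond_error_def
  by (intro divide_nonneg_nonneg sum_nonneg mult_nonneg_nonneg) (auto simp: pattern_nonneg)

lemma measurable_pattern:
  assumes "S \<subseteq> {..<n}"
  shows "(\<lambda>z. pattern n z S) \<in> borel_measurable (T n)"
proof -
  have "(\<lambda>z. p (waiting (fst z) (snd z) j)) \<in> borel_measurable (T n)" if "j < n" for j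
    by (rule measurable_compose[OF measurable_T_waiting[OF that] p_measurable])
  then show ?thesis
    using assms unfolding pattern_def pattern_prob_def
    by (intro borel_measurable_times borel_measurable_prod borel_measurable_diff borel_measurable_const) auto
qed

lemma observe_space: "observe n S x \<in> space (output_space n)"
  by (simp add: observe_def output_space_def space_PiM)

lemma measurable_decoded:
  assumes "decoder r n g"
  shows "(\<lambda>z. decoded n g f z m S) \<in> T n \<rightarrow>\<^sub>M count_space UNIV"
proof -
  let ?B = "Pi\<^sub>M {..<n} (\<lambda>_. borel :: real measure)"
  have g: "g \<in> output_space n \<Otimes>\<^sub>M ?B \<Otimes>\<^sub>M ?B \<rightarrow>\<^sub>M count_space UNIV"
    using assms by (simp add: decoder_def)
  have "(\<lambda>\<tau>. restrict (arrival \<tau>) {..<n}) \<in> ?B \<rightarrow>\<^sub>M ?B"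
    by (intro measurable_restrict measurable_arrival) auto
  then have a: "(\<lambda>z. restrict (arrival (fst z)) {..<n}) \<in> ?B \<Otimes>\<^sub>M ?B \<rightarrow>\<^sub>M ?B"
    by (rule measurable_compose[OF measurable_fst])
  have d: "(\<lambda>z. restrict (departure (fst z) (snd z)) {..<n}) \<in> ?B \<Otimes>\<^sub>M ?B \<rightarrow>\<^sub>M ?B"
    using measurable_departure by (intro measurable_restrict) (auto simp: case_prod_beta)
  show ?thesis unfolding decoded_def measurable_T_cong
    by (rule measurable_compose[OF _ g]) (intro measurable_Pair measurable_const observe_space a d)
qed

lemma measurable_cond_error:
  assumes "decoder r n g"
  shows "cond_error n MM f g \<in> borel_measurable (T n)"
proof -
  have "(\<lambda>z. of_bool (decoded n g f z m S \<noteq> m) :: real) \<in> borel_measurable (T n)" for m S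
    by (rule measurable_compose[OF measurable_decoded[OF assms]]) simp
  then show ?thesis
    unfolding cond_error_def[abs_def]
    by (intro borel_measurable_divide borel_measurable_sum borel_measurable_times
        borel_measurable_const measurable_pattern) auto
qed

lemma emeasure_channel_law:
  assumes "B \<in> sets (output_space n)"
  shows "emeasure (channel_law p n x (fst z) (snd z)) B
    = (\<Sum>S\<in>Pow {..<n}. ennreal (pattern n z S) * indicator B (observe n S x))"
  unfolding channel_law_def pattern_def
  by (rule emeasure_PiM_erase[OF p_range[OF waiting_nonneg] assms])

text \<open>Evaluating the two nested kernels of \<open>joint_law\<close> replaces the channel by
  the finite sum over patterns and the message by an average; finite sums then pass through the
  timing integral. Afterwards every coding argument is carried out for a fixed timing.\<close>

lemma error_prob_eq:
  assumes g: "decoder r n g" and MM: "finite MM" "MM \<noteq> {}"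
  shows "ennreal (error_prob p FA FS n MM f g) = (\<integral>\<^sup>+z. ennreal (cond_error n MM f g z) \<partial>T n)"
proof -
  let ?U = "uniform_count_measure MM"
  let ?P = "?U \<Otimes>\<^sub>M T n"
  let ?O = "output_space n :: (nat \<Rightarrow> 'a option) measure"
  let ?J = "joint_law p FA FS n MM f"
  let ?K = "\<lambda>z. case z of (m, \<tau>, s) \<Rightarrow> channel_law p n (f m) \<tau> s"
  let ?L = "\<lambda>z. ?K z \<bind> (\<lambda>y. return (?P \<Otimes>\<^sub>M ?O) (z, y))"
  let ?w = "\<lambda>m z. \<Sum>S\<in>Pow {..<n}. ennreal (pattern n z S) * of_bool (decoded n g f z m S \<noteq> m)"
  interpret J: prob_space ?J by (rule prob_space_joint_law[OF p_measurable FA FS MM])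
  interpret T: prob_space "T n" by (rule prob_space_T)
  interpret U: prob_space ?U by (rule prob_space_uniform_count_measure[OF MM])
  define B where "B = {z \<in> space ?J. case z of ((m, \<tau>, s), y) \<Rightarrow>
      g (y, restrict (arrival \<tau>) {..<n}, restrict (departure \<tau> s) {..<n}) \<noteq> m}"
  have setsJ: "sets ?J = sets (?P \<Otimes>\<^sub>M ?O)"
    by (rule sets_joint_law[OF p_measurable FA FS MM])
  have B: "B \<in> sets (?P \<Otimes>\<^sub>M ?O)"
    using error_event_measurable[OF g p_measurable FA FS MM, of f] unfolding B_def setsJ .
  have J: "?J = ?P \<bind> ?L"
    unfolding joint_law_def Let_def
    by (intro arg_cong[where f="bind ?P"] ext) (simp split: prod.split)
  have P: "?P \<in> space (prob_algebra ?P)"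
    by (simp add: space_prob_algebra prob_space_pair U.prob_space_axioms T.prob_space_axioms)
  have K: "?K \<in> ?P \<rightarrow>\<^sub>M prob_algebra ?O"
    by (rule measurable_channel_law[OF p_measurable FA(2) FS(2)])
  have L: "?L \<in> ?P \<rightarrow>\<^sub>M prob_algebra (?P \<Otimes>\<^sub>M ?O)"
    by (rule measurable_bind_prob_space2[OF K]) (simp add: case_prod_beta measurable_return_prob_space)
  have "ennreal (error_prob p FA FS n MM f g) = emeasure ?J B"
    unfolding error_prob_def B_def J.emeasure_eq_measure
    by (intro arg_cong[where f=ennreal] arg_cong[where f="measure ?J"]) auto
  also have "\<dots> = (\<integral>\<^sup>+z. emeasure (?L z) B \<partial>?P)"
    unfolding J by (rule emeasure_bind_prob_algebra[OF P L B])
  also have "\<dots> = (\<integral>\<^sup>+z. ?w (fst z) (snd z) \<partial>?P)"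
  proof (rule nn_integral_cong)
    fix z assume z: "z \<in> space ?P"
    have Kz: "?K z \<in> space (prob_algebra ?O)" by (rule measurable_space[OF K z])
    then have setsK: "sets (?K z) = sets ?O" by (simp add: space_prob_algebra)
    have Bz: "Pair z -` B \<in> sets ?O" using B by (rule sets_Pair1)
    have R: "(\<lambda>y. return (?P \<Otimes>\<^sub>M ?O) (z, y)) \<in> ?O \<rightarrow>\<^sub>M prob_algebra (?P \<Otimes>\<^sub>M ?O)"
      by (rule measurable_compose[OF measurable_Pair1'[OF z] measurable_return_prob_space])
    have "emeasure (?L z) B = (\<integral>\<^sup>+y. emeasure (return (?P \<Otimes>\<^sub>M ?O) (z, y)) B \<partial>?K z)"
      by (rule emeasure_bind_prob_algebra[OF Kz R B])
    also have "\<dots> = (\<integral>\<^sup>+y. indicator (Pair z -` B) y \<partial>?K z)"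
      using B by (intro nn_integral_cong) (simp add: indicator_def)
    also have "\<dots> = emeasure (?K z) (Pair z -` B)"
      using Bz setsK by (intro nn_integral_indicator) simp
    also have "\<dots> = (\<Sum>S\<in>Pow {..<n}. ennreal (pattern n (snd z) S)
        * indicator (Pair z -` B) (observe n S (f (fst z))))"
      using emeasure_channel_law[OF Bz] by (simp add: case_prod_beta)
    also have "\<dots> = ?w (fst z) (snd z)"
    proof (rule sum.cong)
      fix S
      have "(z, observe n S (f (fst z))) \<in> B \<longleftrightarrow> decoded n g f (snd z) (fst z) S \<noteq> fst z"
        using z observe_space[of n S "f (fst z)"]
        by (auto simp: B_def sets_eq_imp_space_eq[OF setsJ] space_pair_measure[of ?P ?O]
            decoded_def case_prod_beta)
      then show "ennreal (pattern n (snd z) S) * indicator (Pair z -` B) (observe n S (f (fst z)))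
          = ennreal (pattern n (snd z) S) * of_bool (decoded n g f (snd z) (fst z) S \<noteq> fst z)"
        by (simp add: indicator_def)
    qed simp
    finally show "emeasure (?L z) B = ?w (fst z) (snd z)" .
  qed
  also have "\<dots> = (\<integral>\<^sup>+m. \<integral>\<^sup>+z. ?w m z \<partial>T n \<partial>?U)"
  proof -
    have w: "?w m \<in> borel_measurable (T n)" for m
    proof -
      have [measurable]: "(\<lambda>z. of_bool (decoded n g f z m S \<noteq> m) :: ennreal) \<in> borel_measurable (T n)" for S
        by (rule measurable_compose[OF measurable_decoded[OF g]]) simp
      have "(\<lambda>z. ennreal (pattern n z S) * of_bool (decoded n g f z m S \<noteq> m)) \<in> borel_measurable (T n)"
        if "S \<in> Pow {..<n}" for S
      proof -
        have [measurable]: "(\<lambda>z. pattern n z S) \<in> borel_measurable (T n)"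
          using that by (intro measurable_pattern) simp
        show ?thesis by measurable
      qed
      then show ?thesis by (intro borel_measurable_sum)
    qed
    have "(\<lambda>z. ?w (fst z) (snd z)) \<in> borel_measurable ?P"
    proof (rule measurable_compose_countable[where g=fst])
      show "(\<lambda>z. ?w m (snd z)) \<in> borel_measurable ?P" for m
        by (rule measurable_compose[OF measurable_snd w])
      have "fst \<in> ?P \<rightarrow>\<^sub>M ?U" by measurable
      then show "fst \<in> ?P \<rightarrow>\<^sub>M count_space UNIV"
        by (rule measurable_compose) (auto simp: measurable_def sets_uniform_count_measure space_uniform_count_measure)
    qed
    from T.nn_integral_fst[OF this] show ?thesis by simp
  qed
  also have "\<dots> = (\<Sum>m\<in>MM. ennreal (1 / real (card MM)) * (\<integral>\<^sup>+z. ?w m z \<partial>T n))"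
    unfolding uniform_count_measure_def by (rule nn_integral_point_measure_finite[OF MM(1)])
  also have "\<dots> = (\<Sum>m\<in>MM. \<integral>\<^sup>+z. ennreal (1 / real (card MM)
      * (\<Sum>S\<in>Pow {..<n}. pattern n z S * of_bool (decoded n g f z m S \<noteq> m))) \<partial>T n)"
  proof (rule sum.cong)
    fix m
    let ?v = "\<lambda>z. \<Sum>S\<in>Pow {..<n}. pattern n z S * of_bool (decoded n g f z m S \<noteq> m)"
    have v: "?v \<in> borel_measurable (T n)"
    proof -
      have "(\<lambda>z. of_bool (decoded n g f z m S \<noteq> m) :: real) \<in> borel_measurable (T n)" for S
        by (rule measurable_compose[OF measurable_decoded[OF g]]) simp
      then show ?thesis by (intro borel_measurable_sum borel_measurable_times measurable_pattern) auto
    qed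
    have vw: "?w m z = ennreal (?v z)" for z
    proof -
      have "ennreal (?v z) = (\<Sum>S\<in>Pow {..<n}. ennreal (pattern n z S * of_bool (decoded n g f z m S \<noteq> m)))"
        by (rule sum_ennreal[symmetric]) (auto intro!: mult_nonneg_nonneg pattern_nonneg)
      also have "\<dots> = ?w m z"
        by (rule sum.cong) (auto simp: of_bool_def)
      finally show ?thesis ..
    qed
    have "ennreal (1 / real (card MM)) * (\<integral>\<^sup>+z. ?w m z \<partial>T n)
        = (\<integral>\<^sup>+z. ennreal (1 / real (card MM)) * ennreal (?v z) \<partial>T n)"
      unfolding vw using v by (intro nn_integral_cmult[symmetric]) simp
    also have "\<dots> = (\<integral>\<^sup>+z. ennreal (1 / real (card MM) * ?v z) \<partial>T n)"
      by (intro nn_integral_cong ennreal_mult'[symmetric]) simp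
    finally show "ennreal (1 / real (card MM)) * (\<integral>\<^sup>+z. ?w m z \<partial>T n)
        = (\<integral>\<^sup>+z. ennreal (1 / real (card MM) * ?v z) \<partial>T n)" .
  qed simp
  also have "\<dots> = (\<integral>\<^sup>+z. (\<Sum>m\<in>MM. ennreal (1 / real (card MM)
      * (\<Sum>S\<in>Pow {..<n}. pattern n z S * of_bool (decoded n g f z m S \<noteq> m)))) \<partial>T n)"
  proof (rule nn_integral_sum[symmetric])
    fix m
    have "(\<lambda>z. of_bool (decoded n g f z m S \<noteq> m) :: real) \<in> borel_measurable (T n)" for S
      by (rule measurable_compose[OF measurable_decoded[OF g]]) simp
    then have [measurable]: "(\<lambda>z. \<Sum>S\<in>Pow {..<n}. pattern n z S * of_bool (decoded n g f z m S \<noteq> m))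
        \<in> borel_measurable (T n)"
      by (intro borel_measurable_sum borel_measurable_times measurable_pattern) auto
    show "(\<lambda>z. ennreal (1 / real (card MM)
        * (\<Sum>S\<in>Pow {..<n}. pattern n z S * of_bool (decoded n g f z m S \<noteq> m)))) \<in> borel_measurable (T n)"
      by measurable
  qed
  also have "\<dots> = (\<integral>\<^sup>+z. ennreal (cond_error n MM f g z) \<partial>T n)"
  proof (rule nn_integral_cong)
    fix z
    have "(\<Sum>m\<in>MM. ennreal (1 / real (card MM)
        * (\<Sum>S\<in>Pow {..<n}. pattern n z S * of_bool (decoded n g f z m S \<noteq> m))))
      = ennreal (\<Sum>m\<in>MM. 1 / real (card MM)
        * (\<Sum>S\<in>Pow {..<n}. pattern n z S * of_bool (decoded n g f z m S \<noteq> m)))"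
      by (rule sum_ennreal) (auto intro!: mult_nonneg_nonneg sum_nonneg pattern_nonneg divide_nonneg_nonneg)
    also have "\<dots> = ennreal (cond_error n MM f g z)"
      by (simp only: sum_divide_distrib[symmetric] cond_error_def times_divide_eq_left mult_1)
    finally show "(\<Sum>m\<in>MM. ennreal (1 / real (card MM)
        * (\<Sum>S\<in>Pow {..<n}. pattern n z S * of_bool (decoded n g f z m S \<noteq> m))))
      = ennreal (cond_error n MM f g z)" .
  qed
  finally show ?thesis .
qed

end

context queue_channel
begin

text \<open>Exchanging the sums over messages and patterns leaves, for each pattern, the fraction of
  messages decoded correctly, which the counting bound limits.\<close>

lemma correct_le:
  fixes f :: "nat \<Rightarrow> nat \<Rightarrow> bool"
  assumes MM: "finite MM" "MM \<noteq> {}"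
  shows "1 - cond_error n MM f g z
    \<le> (\<Sum>S\<in>Pow {..<n}. pattern n z S * min 1 (2 ^ card S / real (card MM)))"
proof -
  let ?M = "real (card MM)"
  let ?e = "\<lambda>m S. of_bool (decoded n g f z m S \<noteq> m) :: real"
  have M: "0 < ?M" using MM by (simp add: card_gt_0_iff)
  have "(\<Sum>m\<in>MM. \<Sum>S\<in>Pow {..<n}. pattern n z S) = ?M"
    by (simp add: sum_pattern)
  then have "1 - cond_error n MM f g z
      = ((\<Sum>m\<in>MM. \<Sum>S\<in>Pow {..<n}. pattern n z S) - (\<Sum>m\<in>MM. \<Sum>S\<in>Pow {..<n}. pattern n z S * ?e m S)) / ?M"
    using M by (simp add: cond_error_def diff_divide_distrib)
  also have "\<dots> = (\<Sum>m\<in>MM. \<Sum>S\<in>Pow {..<n}. pattern n z S * (1 - ?e m S)) / ?M"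
    by (simp only: sum_subtractf[symmetric] right_diff_distrib mult_1_right)
  also have "\<dots> = (\<Sum>S\<in>Pow {..<n}. pattern n z S * ((\<Sum>m\<in>MM. 1 - ?e m S) / ?M))"
    by (subst sum.swap) (simp only: sum_divide_distrib sum_distrib_left times_divide_eq_right)
  also have "\<dots> \<le> (\<Sum>S\<in>Pow {..<n}. pattern n z S * min 1 (2 ^ card S / ?M))"
  proof (intro sum_mono mult_left_mono)
    fix S assume S: "S \<in> Pow {..<n}"
    show "0 \<le> pattern n z S" using S by (simp add: pattern_nonneg)
    \<comment> \<open>With the timing frozen, a decoder that sees the times is just a function of
      the output, so the counting bound applies to it as well.\<close>
    let ?g = "\<lambda>y. g (y, restrict (arrival (fst z)) {..<n}, restrict (departure (fst z) (snd z)) {..<n})"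
    have "(\<Sum>m\<in>MM. 1 - ?e m S) = (\<Sum>m\<in>MM. of_bool (?g (observe n S (f m)) = m))"
      by (rule sum.cong) (auto simp: decoded_def)
    also have "\<dots> = real (card {m \<in> MM. ?g (observe n S (f m)) = m})"
      using MM by (simp add: Collect_conj_eq)
    finally have eq: "(\<Sum>m\<in>MM. 1 - ?e m S) = real (card {m \<in> MM. ?g (observe n S (f m)) = m})" .
    have "card {m \<in> MM. ?g (observe n S (f m)) = m} \<le> 2 ^ card S"
      using S by (intro card_correct_le) simp
    from of_nat_mono[OF this, where 'a=real]
    have "real (card {m \<in> MM. ?g (observe n S (f m)) = m}) \<le> 2 ^ card S" by simp
    moreover have "real (card {m \<in> MM. ?g (observe n S (f m)) = m}) \<le> ?M"
      using MM by (intro of_nat_mono card_mono) auto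
    ultimately show "(\<Sum>m\<in>MM. 1 - ?e m S) / ?M \<le> min 1 (2 ^ card S / ?M)"
      unfolding eq using M by (simp add: divide_right_mono)
  qed
  finally show ?thesis .
qed

lemma sum_codebook_cond_error_le:
  assumes MM: "finite MM" "MM \<noteq> {}"
  shows "(\<Sum>f\<in>codebooks MM n. cond_error n MM f (\<lambda>(y, a, d). match_decoder MM n f y) z)
    \<le> real (card (codebooks MM n)) *
      (\<Sum>S\<in>Pow {..<n}. pattern n z S * min 1 (real (card MM) / 2 ^ card S))"
proof -
  let ?F = "codebooks MM n" and ?M = "real (card MM)"
  let ?e = "\<lambda>f m S. of_bool (match_decoder MM n f (observe n S (f m)) \<noteq> m) :: real"
  have M: "0 < ?M" using MM by (simp add: card_gt_0_iff)
  have "(\<Sum>f\<in>?F. cond_error n MM f (\<lambda>(y, a, d). match_decoder MM n f y) z)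
      = (\<Sum>f\<in>?F. \<Sum>m\<in>MM. \<Sum>S\<in>Pow {..<n}. pattern n z S * ?e f m S) / ?M"
    by (simp add: cond_error_def decoded_def sum_divide_distrib)
  also have "\<dots> = (\<Sum>m\<in>MM. \<Sum>S\<in>Pow {..<n}. \<Sum>f\<in>?F. pattern n z S * ?e f m S) / ?M"
    by (subst sum.swap) (simp only: sum.swap[of _ ?F])
  also have "\<dots> \<le> (\<Sum>m\<in>MM. \<Sum>S\<in>Pow {..<n}. pattern n z S * (real (card ?F) * min 1 (?M / 2 ^ card S))) / ?M"
    unfolding sum_distrib_left[symmetric]
    by (intro divide_right_mono sum_mono mult_left_mono sum_codebook_errors_le)
      (auto simp: MM pattern_nonneg)
  also have "\<dots> = (\<Sum>S\<in>Pow {..<n}. pattern n z S * (real (card ?F) * min 1 (?M / 2 ^ card S)))"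
    using M by simp
  also have "\<dots> = real (card ?F) * (\<Sum>S\<in>Pow {..<n}. pattern n z S * min 1 (?M / 2 ^ card S))"
    by (simp only: sum_distrib_left mult.left_commute)
  finally show ?thesis .
qed

text \<open>The output space is discrete on a finite set, so measurability is automatic, and
  independence of the times meets the stricter receiver condition.\<close>

lemma decoder_match: "decoder r n (\<lambda>(y, a, d). match_decoder MM n (f :: nat \<Rightarrow> nat \<Rightarrow> bool) y)"
proof -
  have "output_space n = count_space ({..<n} \<rightarrow>\<^sub>E (UNIV :: bool option set))"
    unfolding output_space_def by (intro count_space_PiM_finite) auto
  then have "match_decoder MM n f \<in> output_space n \<rightarrow>\<^sub>M count_space UNIV" by simp
  then show ?thesis
    unfolding decoder_def case_prod_beta by (auto intro: measurable_compose[OF measurable_fst])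
qed

lemma sum_pattern_chebyshev_le:
  assumes a: "0 \<le> a" and b: "0 < b"
  shows "(\<Sum>S\<in>Pow {..<n}. pattern n z S * (a + (real (card S) - c)\<^sup>2 / b))
    \<le> a + (((\<Sum>j<n. 1 - p (waiting (fst z) (snd z) j)) - c)\<^sup>2 + real n) / b"
proof -
  let ?q = "\<lambda>j. p (waiting (fst z) (snd z) j)"
  have q: "0 \<le> ?q j \<and> ?q j \<le> 1" for j by (rule p_range[OF waiting_nonneg])
  have "(\<Sum>j<n. ?q j * (1 - ?q j)) \<le> (\<Sum>j<n. 1)"
    using q by (intro sum_mono mult_le_one) auto
  then have le: "(\<Sum>S\<in>Pow {..<n}. pattern n z S * (real (card S) - c)\<^sup>2)
      \<le> ((\<Sum>j<n. 1 - ?q j) - c)\<^sup>2 + real n"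
    unfolding pattern_def pattern_card_second_moment by simp
  have "(\<Sum>S\<in>Pow {..<n}. pattern n z S * (a + (real (card S) - c)\<^sup>2 / b))
      = a * (\<Sum>S\<in>Pow {..<n}. pattern n z S) + (\<Sum>S\<in>Pow {..<n}. pattern n z S * (real (card S) - c)\<^sup>2) / b"
    by (simp add: distrib_left sum.distrib sum_distrib_left sum_divide_distrib mult.commute)
  also have "\<dots> \<le> a + (((\<Sum>j<n. 1 - ?q j) - c)\<^sup>2 + real n) / b"
    using le b by (simp add: sum_pattern divide_right_mono)
  finally show ?thesis .
qed

end

section \<open>Converse and random coding for the exponential queue\<close>

context mm1
begin

sublocale queue_channel "exponential_law l" "exponential_law 1" "\<lambda>w. 1 - exp (- \<kappa> * w)"
  by (rule queue_channel.intro[OF timing_axioms queue_channel_axioms.intro]) (use \<kappa> in auto)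

abbreviation "err n \<equiv> error_prob (\<lambda>w. 1 - exp (- \<kappa> * w)) (exponential_law l) (exponential_law 1) n"

text \<open>The averaged right side of the two Chebyshev lemmas: \<open>dev_bound\<close> accounts
  for the fluctuation of the timing and the summand 1 for the erasures given the timing, whose
  variance is at most n. The second term is of order 1 / n.\<close>

definition "overhead n \<eta> = 2 powr (- real n * \<eta>) + real n * (dev_bound + 1) / (real n * \<eta>)\<^sup>2"

lemma overhead_nonneg: "0 \<le> overhead n \<eta>"
  using dev_bound_nonneg by (simp add: overhead_def)

lemma overhead_tendsto_0:
  assumes \<eta>: "0 < \<eta>"
  shows "(\<lambda>n. overhead n \<eta>) \<longlonglongrightarrow> 0"
proof -
  have "(2 powr (- \<eta>)) ^ n = 2 powr (- real n * \<eta>)" for n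
    by (simp add: powr_powr[symmetric] powr_realpow[symmetric] powr_powr mult.commute)
  moreover have "2 powr (- \<eta>) < 2 powr 0" using \<eta> by (intro powr_less_mono) auto
  ultimately have 1: "(\<lambda>n. 2 powr (- real n * \<eta>)) \<longlonglongrightarrow> 0"
    using LIMSEQ_realpow_zero[of "2 powr (- \<eta>)"] by simp
  have "(\<lambda>n. (dev_bound + 1) / \<eta>\<^sup>2 * inverse (real n)) \<longlonglongrightarrow> (dev_bound + 1) / \<eta>\<^sup>2 * 0"
    by (intro tendsto_mult tendsto_const lim_inverse_n)
  moreover have "(dev_bound + 1) / \<eta>\<^sup>2 * inverse (real n) = real n * (dev_bound + 1) / (real n * \<eta>)\<^sup>2" for n
    using \<eta> by (cases "n = 0") (auto simp: power_mult_distrib power2_eq_square field_simps)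
  ultimately have 2: "(\<lambda>n. real n * (dev_bound + 1) / (real n * \<eta>)\<^sup>2) \<longlonglongrightarrow> 0" by simp
  from tendsto_add[OF 1 2] show ?thesis by (simp add: overhead_def)
qed

lemma nn_integral_chebyshev_le:
  assumes n: "0 < n" and \<eta>: "0 < \<eta>"
  shows "(\<integral>\<^sup>+z. ennreal (2 powr (- real n * \<eta>) + ((G n z - real n * \<rho>)\<^sup>2 + real n) / (real n * \<eta>)\<^sup>2) \<partial>T n)
    \<le> ennreal (overhead n \<eta>)"
proof -
  interpret prob_space "T n" by (rule prob_space_T)
  let ?b = "(real n * \<eta>)\<^sup>2" and ?a = "2 powr (- real n * \<eta>)"
  have b: "0 < ?b" using n \<eta> by simp
  have "?a + ((G n z - real n * \<rho>)\<^sup>2 + real n) / ?b = (?a + real n / ?b) + 1 / ?b * (G n z - real n * \<rho>)\<^sup>2" for z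
    by (simp add: add_divide_distrib)
  moreover have "ennreal ((?a + real n / ?b) + 1 / ?b * (G n z - real n * \<rho>)\<^sup>2)
      = ennreal (?a + real n / ?b) + ennreal (1 / ?b) * ennreal ((G n z - real n * \<rho>)\<^sup>2)" for z
  proof -
    have "ennreal ((?a + real n / ?b) + 1 / ?b * (G n z - real n * \<rho>)\<^sup>2)
        = ennreal (?a + real n / ?b) + ennreal (1 / ?b * (G n z - real n * \<rho>)\<^sup>2)"
      by (rule ennreal_plus) simp_all
    also have "ennreal (1 / ?b * (G n z - real n * \<rho>)\<^sup>2) = ennreal (1 / ?b) * ennreal ((G n z - real n * \<rho>)\<^sup>2)"
      by (rule ennreal_mult') simp
    finally show ?thesis .
  qed
  ultimately have eq: "ennreal (?a + ((G n z - real n * \<rho>)\<^sup>2 + real n) / ?b)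
      = ennreal (?a + real n / ?b) + ennreal (1 / ?b) * ennreal ((G n z - real n * \<rho>)\<^sup>2)" for z
    by (simp only:)
  have "(\<integral>\<^sup>+z. ennreal (?a + ((G n z - real n * \<rho>)\<^sup>2 + real n) / ?b) \<partial>T n)
      = ennreal (?a + real n / ?b) + ennreal (1 / ?b) * (\<integral>\<^sup>+z. ennreal ((G n z - real n * \<rho>)\<^sup>2) \<partial>T n)"
    unfolding eq by (simp add: nn_integral_add nn_integral_cmult emeasure_space_1 del: ennreal_plus)
  also have "\<dots> \<le> ennreal (?a + real n / ?b) + ennreal (1 / ?b) * ennreal (real n * dev_bound)"
    by (intro add_left_mono mult_left_mono G_second_moment n) simp
  also have "\<dots> = ennreal (?a + real n / ?b + 1 / ?b * (real n * dev_bound))"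
  proof -
    have "ennreal (1 / ?b) * ennreal (real n * dev_bound) = ennreal (1 / ?b * (real n * dev_bound))"
      by (rule ennreal_mult'[symmetric]) simp
    moreover have "ennreal (?a + real n / ?b) + ennreal (1 / ?b * (real n * dev_bound))
        = ennreal (?a + real n / ?b + 1 / ?b * (real n * dev_bound))"
      using dev_bound_nonneg by (intro ennreal_plus[symmetric]) auto
    ultimately show ?thesis by (simp only:)
  qed
  also have "?a + real n / ?b + 1 / ?b * (real n * dev_bound) = overhead n \<eta>"
    by (simp add: overhead_def add_divide_distrib distrib_left)
  finally show ?thesis .
qed

text \<open>The function h stands for either minimum, 2^k / M in the converse and M / 2^k in the
  coding bound, so that both share one averaging.\<close>

lemma pattern_bound:
  assumes n: "0 < n" and \<eta>: "0 < \<eta>"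
    and h: "\<And>k. h k \<le> 2 powr (- real n * \<eta>) + (real k - real n * \<rho>)\<^sup>2 / (real n * \<eta>)\<^sup>2"
  shows "(\<Sum>S\<in>Pow {..<n}. pattern n z S * h (card S))
    \<le> 2 powr (- real n * \<eta>) + ((G n z - real n * \<rho>)\<^sup>2 + real n) / (real n * \<eta>)\<^sup>2"
proof -
  have "(\<Sum>S\<in>Pow {..<n}. pattern n z S * h (card S))
      \<le> (\<Sum>S\<in>Pow {..<n}. pattern n z S * (2 powr (- real n * \<eta>) + (real (card S) - real n * \<rho>)\<^sup>2 / (real n * \<eta>)\<^sup>2))"
    by (intro sum_mono mult_left_mono h pattern_nonneg) auto
  also have "\<dots> \<le> 2 powr (- real n * \<eta>) + ((G n z - real n * \<rho>)\<^sup>2 + real n) / (real n * \<eta>)\<^sup>2"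
    using sum_pattern_chebyshev_le[of "2 powr (- real n * \<eta>)" "(real n * \<eta>)\<^sup>2" n z "real n * \<rho>"] n \<eta>
    by (simp add: G_def)
  finally show ?thesis .
qed

text \<open>A strong converse: above the threshold the error probability tends to 1, since the
  probability of success is at most the overhead. The additive form avoids subtraction in the
  extended nonnegative reals.\<close>

lemma converse_error:
  fixes f :: "nat \<Rightarrow> nat \<Rightarrow> bool"
  assumes n: "0 < n" and \<eta>: "0 < \<eta>" and g: "decoder r n g" and MM: "finite MM"
    and M: "2 powr (real n * (\<rho> + 2 * \<eta>)) \<le> real (card MM)"
  shows "1 \<le> err n MM f g + overhead n \<eta>"
proof -
  interpret T: prob_space "T n" by (rule prob_space_T)
  have MM0: "MM \<noteq> {}" using M by (auto simp: not_le)
  let ?R = "\<lambda>z. 2 powr (- real n * \<eta>) + ((G n z - real n * \<rho>)\<^sup>2 + real n) / (real n * \<eta>)\<^sup>2"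
  note [measurable] = measurable_cond_error[OF g, of MM f]
  have R0: "0 \<le> ?R z" for z by (intro add_nonneg_nonneg divide_nonneg_nonneg) auto
  have "1 = (\<integral>\<^sup>+z. 1 \<partial>T n)" by (simp add: T.emeasure_space_1)
  also have "\<dots> \<le> (\<integral>\<^sup>+z. ennreal (cond_error n MM f g z) + ennreal (?R z) \<partial>T n)"
  proof (rule nn_integral_mono)
    fix z
    have "1 - cond_error n MM f g z
        \<le> (\<Sum>S\<in>Pow {..<n}. pattern n z S * min 1 (2 ^ card S / real (card MM)))"
      by (rule correct_le[OF MM MM0])
    also have "\<dots> \<le> ?R z"
      by (rule pattern_bound[OF n \<eta>]) (rule chebyshev_overshoot[OF n \<eta> M])
    finally have "1 \<le> cond_error n MM f g z + ?R z" by simp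
    then have "ennreal 1 \<le> ennreal (cond_error n MM f g z + ?R z)" by (rule ennreal_leI)
    also have "\<dots> = ennreal (cond_error n MM f g z) + ennreal (?R z)"
      by (rule ennreal_plus[OF cond_error_nonneg R0])
    finally show "1 \<le> ennreal (cond_error n MM f g z) + ennreal (?R z)" by simp
  qed
  also have "\<dots> = ennreal (err n MM f g) + (\<integral>\<^sup>+z. ennreal (?R z) \<partial>T n)"
    unfolding error_prob_eq[OF g MM MM0] by (rule nn_integral_add) measurable
  also have "\<dots> \<le> ennreal (err n MM f g) + ennreal (overhead n \<eta>)"
    by (intro add_left_mono nn_integral_chebyshev_le n \<eta>)
  also have "\<dots> = ennreal (err n MM f g + overhead n \<eta>)"
    by (intro ennreal_plus[symmetric] overhead_nonneg) (simp add: error_prob_def)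
  finally show ?thesis by (simp add: ennreal_le_iff2 one_ennreal_def[symmetric] flip: ennreal_1)
qed

text \<open>If every codebook exceeded the bound, so would their sum. That sum is bounded inside the
  integral, for each timing, and only then integrated; hence one codebook is good on average over
  the timing, with an encoder that does not know it.\<close>

lemma random_coding_error:
  assumes n: "0 < n" and \<eta>: "0 < \<eta>" and MM: "finite MM" "MM \<noteq> {}"
    and M: "real (card MM) \<le> 2 powr (real n * (\<rho> - 2 * \<eta>))"
  shows "\<exists>(f :: nat \<Rightarrow> nat \<Rightarrow> bool) g. decoder r n g \<and> err n MM f g \<le> overhead n \<eta>"
proof (rule ccontr)
  let ?F = "codebooks MM n" and ?g = "\<lambda>f (y, a, d). match_decoder MM n f y"
  let ?R = "\<lambda>z. 2 powr (- real n * \<eta>) + ((G n z - real n * \<rho>)\<^sup>2 + real n) / (real n * \<eta>)\<^sup>2"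
  let ?c = "real (card ?F)"
  note g = decoder_match[of r n MM]
  note [measurable] = measurable_cond_error[OF g]
  assume "\<not> ?thesis"
  then have "overhead n \<eta> < err n MM f (?g f)" for f :: "nat \<Rightarrow> nat \<Rightarrow> bool"
    using g[of f] by (auto simp: not_le)
  then have "(\<Sum>f\<in>?F. overhead n \<eta>) < (\<Sum>f\<in>?F. err n MM f (?g f))"
    by (intro sum_strict_mono finite_codebooks MM codebooks_nonempty)
  moreover have "ennreal (\<Sum>f\<in>?F. err n MM f (?g f)) \<le> ennreal (?c * overhead n \<eta>)"
  proof -
    have "ennreal (\<Sum>f\<in>?F. err n MM f (?g f)) = (\<Sum>f\<in>?F. ennreal (err n MM f (?g f)))"
      by (rule sum_ennreal[symmetric]) (simp add: error_prob_def)
    also have "\<dots> = (\<Sum>f\<in>?F. \<integral>\<^sup>+z. ennreal (cond_error n MM f (?g f) z) \<partial>T n)"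
      by (intro sum.cong refl error_prob_eq[OF g MM])
    also have "\<dots> = (\<integral>\<^sup>+z. (\<Sum>f\<in>?F. ennreal (cond_error n MM f (?g f) z)) \<partial>T n)"
      by (rule nn_integral_sum[symmetric]) measurable
    also have "\<dots> \<le> (\<integral>\<^sup>+z. ennreal ?c * ennreal (?R z) \<partial>T n)"
    proof (rule nn_integral_mono)
      fix z
      have "(\<Sum>f\<in>?F. cond_error n MM f (?g f) z)
          \<le> ?c * (\<Sum>S\<in>Pow {..<n}. pattern n z S * min 1 (real (card MM) / 2 ^ card S))"
        by (rule sum_codebook_cond_error_le[OF MM])
      also have "\<dots> \<le> ?c * ?R z"
        by (intro mult_left_mono pattern_bound[OF n \<eta>] chebyshev_undershoot[OF n \<eta> M]) simp
      finally have le: "(\<Sum>f\<in>?F. cond_error n MM f (?g f) z) \<le> ?c * ?R z" .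
      have "(\<Sum>f\<in>?F. ennreal (cond_error n MM f (?g f) z)) = ennreal (\<Sum>f\<in>?F. cond_error n MM f (?g f) z)"
        by (rule sum_ennreal[OF cond_error_nonneg])
      also have "\<dots> \<le> ennreal (?c * ?R z)" by (rule ennreal_leI[OF le])
      also have "\<dots> = ennreal ?c * ennreal (?R z)" by (rule ennreal_mult') simp
      finally show "(\<Sum>f\<in>?F. ennreal (cond_error n MM f (?g f) z)) \<le> ennreal ?c * ennreal (?R z)" .
    qed
    also have "\<dots> = ennreal ?c * (\<integral>\<^sup>+z. ennreal (?R z) \<partial>T n)"
      by (rule nn_integral_cmult) measurable
    also have "\<dots> \<le> ennreal ?c * ennreal (overhead n \<eta>)"
      by (intro mult_left_mono nn_integral_chebyshev_le n \<eta>) simp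
    also have "\<dots> = ennreal (?c * overhead n \<eta>)"
      by (rule ennreal_mult'[symmetric]) simp
    finally show ?thesis .
  qed
  then have "(\<Sum>f\<in>?F. err n MM f (?g f)) \<le> ?c * overhead n \<eta>"
    by (rule ennreal_le_iff[THEN iffD1, rotated]) (simp add: overhead_nonneg)
  ultimately show False by simp
qed

abbreviation "ach r \<equiv> achievable (UNIV :: bool set) (\<lambda>w. 1 - exp (- \<kappa> * w)) (exponential_law l) (exponential_law 1) r"

text \<open>A block lasts at least n / l on average, so a rate above l \<rho> needs more than n
  (\<rho> + 2 \<eta>) message bits. As the error then tends to 1, the single tolerance 1 / 2 gives
  the contradiction.\<close>

lemma rate_le_of_achievable:
  assumes "ach r R"
  shows "R \<le> l * \<rho>"
proof (rule ccontr)
  assume "\<not> R \<le> l * \<rho>"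
  define \<delta> where "\<delta> = (R - l * \<rho>) / 2"
  \<comment> \<open>Chosen so that n (\<rho> + 2 \<eta>) = (n / l) (l \<rho> + \<delta>), where l
    \<rho> + \<delta> = R - \<delta> is the guaranteed rate.\<close>
  define \<eta> where "\<eta> = \<delta> / (2 * l)"
  have \<delta>: "0 < \<delta>" "0 < \<eta>" using \<open>\<not> R \<le> l * \<rho>\<close> l by (auto simp: \<delta>_def \<eta>_def)
  have "(1 / 2 :: real) \<in> {0<..<1}" by simp
  with assms \<delta>(1) have "\<forall>\<^sub>F n in sequentially. \<exists>R' T MM (f :: nat \<Rightarrow> nat \<Rightarrow> bool) g.
      code UNIV (exponential_law l) (exponential_law 1) r n R' T MM f g
      \<and> err n MM f g < 1 / 2 \<and> real n * R' / T > R - \<delta>"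
    unfolding achievable_def by blast
  moreover have "\<forall>\<^sub>F n in sequentially. overhead n \<eta> < 1 / 2"
    by (rule order_tendstoD(2)[OF overhead_tendsto_0[OF \<delta>(2)]]) simp
  moreover have "\<forall>\<^sub>F n in sequentially. 0 < (n :: nat)" by (rule eventually_gt_at_top)
  ultimately have "\<forall>\<^sub>F n in sequentially. False"
  proof eventually_elim
    case (elim n)
    then obtain R' t MM and f :: "nat \<Rightarrow> nat \<Rightarrow> bool" and g where
      code: "code UNIV (exponential_law l) (exponential_law 1) r n R' t MM f g"
      and e: "err n MM f g < 1 / 2" and rate: "real n * R' / t > R - \<delta>" by blast
    have g: "decoder r n g" and MM: "finite MM" and card: "real (card MM) = 2 powr (real n * R')"
      and t: "(\<integral>\<^sup>+(\<tau>, s). ennreal (completion n \<tau> s) \<partial>T n) < ennreal t"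
      using code by (auto simp: code_def)
    have "ennreal (real n / l) < ennreal t"
      using completion_mean(1)[OF elim(3)] t by (rule order_le_less_trans)
    then have t': "real n / l < t" using l by (simp add: ennreal_less_iff)
    have pos: "0 < real n / l" using elim(3) l by simp
    have R: "R - \<delta> = l * \<rho> + \<delta>" by (simp add: \<delta>_def field_simps)
    have "real n * (\<rho> + 2 * \<eta>) = real n / l * (l * \<rho> + \<delta>)"
      using l by (simp add: \<eta>_def field_simps)
    also have "\<dots> \<le> t * (l * \<rho> + \<delta>)"
      using t' l \<rho> \<delta> by (intro mult_right_mono) auto
    also have "\<dots> < t * (real n * R' / t)"
      using rate pos t' unfolding R by (intro mult_strict_left_mono) auto
    also have "\<dots> = real n * R'" using pos t' by simp
    finally have "2 powr (real n * (\<rho> + 2 * \<eta>)) \<le> real (card MM)"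
      unfolding card by (intro powr_mono) auto
    from converse_error[OF elim(3) \<delta>(2) g MM this, of f] e elim(2) show ?case by simp
  qed
  then show False by simp
qed

text \<open>The slack \<delta> in the definition lets the supremum itself be achievable: \<rho> - 2
  \<eta> bits per symbol are sent in a time n / l + O(sqrt n).\<close>

lemma achievable_rate: "ach r (l * \<rho>)"
  unfolding achievable_def
proof (intro ballI allI impI)
  fix \<epsilon> \<delta> :: real assume \<epsilon>: "\<epsilon> \<in> {0<..<1}" and \<delta>: "0 < \<delta>"
  \<comment> \<open>The first bound makes the rate loss 2 l \<eta> at most \<delta> / 2; the second
    keeps the number of message bits nonnegative.\<close>
  define \<eta> where "\<eta> = min (\<delta> / (4 * l)) (\<rho> / 2)"
  define c where "c = 2 / l\<^sup>2 + 3"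
  have \<eta>: "0 < \<eta>" "0 \<le> \<rho> - 2 * \<eta>" using \<delta> l \<rho> by (auto simp: \<eta>_def)
  have "\<eta> \<le> \<delta> / (4 * l)" by (simp add: \<eta>_def)
  then have "l * \<eta> \<le> \<delta> / 4" using l by (simp add: field_simps)
  then have l\<eta>: "l * \<rho> - \<delta> < l * (\<rho> - 2 * \<eta>)" using \<delta> by (simp add: algebra_simps)
  \<comment> \<open>The guaranteed rate with numerator and denominator divided by n. In the
    numerator 1 / n is the loss from rounding the message length; in the denominator the terms come
    from the arrivals, the mean sojourn time, and the extra time unit in t.\<close>
  have lim: "(\<lambda>n. ((\<rho> - 2 * \<eta>) - inverse (real n)) / (1 / l + inverse (sqrt (real n)) * c + inverse (real n)))
      \<longlonglongrightarrow> ((\<rho> - 2 * \<eta>) - 0) / (1 / l + 0 * c + 0)"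
    by (intro tendsto_divide tendsto_diff tendsto_add tendsto_mult tendsto_const lim_inverse_n
        tendsto_inverse_0_at_top filterlim_compose[OF sqrt_at_top filterlim_real_sequentially])
      (use l in auto)
  have "\<forall>\<^sub>F n in sequentially. l * \<rho> - \<delta>
      < ((\<rho> - 2 * \<eta>) - inverse (real n)) / (1 / l + inverse (sqrt (real n)) * c + inverse (real n))"
    by (rule order_tendstoD(1)[OF lim]) (use l\<eta> in \<open>simp add: mult.commute\<close>)
  moreover have "\<forall>\<^sub>F n in sequentially. overhead n \<eta> < \<epsilon>"
    by (rule order_tendstoD(2)[OF overhead_tendsto_0[OF \<eta>(1)]]) (use \<epsilon> in simp)
  moreover have "\<forall>\<^sub>F n in sequentially. 0 < (n :: nat)" by (rule eventually_gt_at_top)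
  ultimately show "\<forall>\<^sub>F n in sequentially. \<exists>R' T MM (f :: nat \<Rightarrow> nat \<Rightarrow> bool) g.
      code UNIV (exponential_law l) (exponential_law 1) r n R' T MM f g
      \<and> err n MM f g < \<epsilon> \<and> real n * R' / T > l * \<rho> - \<delta>"
  proof eventually_elim
    case (elim n)
    \<comment> \<open>The number of messages must be an integer equal to 2 to the power n R', so the
      message length is rounded down to k bits and R' = k / n.\<close>
    define k where "k = nat \<lfloor>real n * (\<rho> - 2 * \<eta>)\<rfloor>"
    \<comment> \<open>The summand 1 makes the inequality for the mean completion time strict, as a
      code demands.\<close>
    define t where "t = real n / l + sqrt (real n) * c + 1"
    have x: "0 \<le> real n * (\<rho> - 2 * \<eta>)" using \<eta> by simp
    then have k: "real k \<le> real n * (\<rho> - 2 * \<eta>)" "real n * (\<rho> - 2 * \<eta>) - 1 \<le> real k"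
      by (auto simp: k_def)
    have c: "0 \<le> c" by (simp add: c_def)
    have "0 < real n / l" using elim(3) l by simp
    then have t: "0 < t" using c by (simp add: t_def add_pos_nonneg)
    have "real (card {..<(2::nat) ^ k}) \<le> 2 powr (real n * (\<rho> - 2 * \<eta>))"
      using k(1) by (simp add: powr_realpow[symmetric] powr_mono)
    moreover have "{..<(2::nat) ^ k} \<noteq> {}" by (simp add: lessThan_empty_iff)
    ultimately obtain f :: "nat \<Rightarrow> nat \<Rightarrow> bool" and g
      where g: "decoder r n g" and e: "err n {..<2 ^ k} f g \<le> overhead n \<eta>"
      using random_coding_error[OF elim(3) \<eta>(1), of "{..<2 ^ k}" r] by blast
    have "(\<integral>\<^sup>+(\<tau>, s). ennreal (completion n \<tau> s) \<partial>T n) \<le> ennreal (real n / l + sqrt (real n) * c)"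
      unfolding c_def by (rule completion_mean(2)[OF elim(3)])
    also have "\<dots> < ennreal t"
      using l c by (simp add: t_def ennreal_less_iff)
    finally have "code UNIV (exponential_law l) (exponential_law 1) r n (real k / real n) t {..<2 ^ k} f g"
      using g elim(3) by (simp add: code_def powr_realpow)
    moreover have "l * \<rho> - \<delta> < real n * (real k / real n) / t"
    proof -
      have "((\<rho> - 2 * \<eta>) - inverse (real n)) / (1 / l + inverse (sqrt (real n)) * c + inverse (real n))
          = (real n * ((\<rho> - 2 * \<eta>) - inverse (real n))) / (real n * (1 / l + inverse (sqrt (real n)) * c + inverse (real n)))"
        using elim(3) by simp
      also have "real n * ((\<rho> - 2 * \<eta>) - inverse (real n)) = real n * (\<rho> - 2 * \<eta>) - 1"
        using elim(3) by (simp add: right_diff_distrib)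
      also have "real n * (1 / l + inverse (sqrt (real n)) * c + inverse (real n)) = t"
      proof -
        have "real n * inverse (sqrt (real n)) = sqrt (real n)"
          using real_div_sqrt[of "real n"] by (simp add: divide_inverse)
        then show ?thesis using elim(3) by (simp add: t_def distrib_left mult.assoc[symmetric])
      qed
      finally have "l * \<rho> - \<delta> < (real n * (\<rho> - 2 * \<eta>) - 1) / t" using elim(1) by simp
      also have "\<dots> \<le> real k / t" using k(2) t by (intro divide_right_mono) auto
      finally show ?thesis using elim(3) by simp
    qed
    ultimately show ?case using e elim(2) by (meson order_le_less_trans)
  qed
qed

lemma capacity_eq:
  "capacity (UNIV :: bool set) (\<lambda>w. 1 - exp (- \<kappa> * w)) (exponential_law l) (exponential_law 1) r
    = ereal (l * \<rho>)"
  unfolding capacity_def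
proof (rule antisym)
  show "(SUP R\<in>{R. ach r R}. ereal R) \<le> ereal (l * \<rho>)"
  proof (rule SUP_least)
    fix R assume "R \<in> {R. ach r R}"
    then have "ach r R" by (rule CollectD)
    then show "ereal R \<le> ereal (l * \<rho>)" by (simp only: ereal_less_eq rate_le_of_achievable)
  qed
  show "ereal (l * \<rho>) \<le> (SUP R\<in>{R. ach r R}. ereal R)"
    by (rule SUP_upper, rule CollectI, rule achievable_rate)
qed

end

section \<open>The capacity formula and its unique maximizer\<close>

theorem corollary1:
  fixes \<kappa> \<alpha> :: real and r :: receiver and C :: "real \<Rightarrow> ereal"
  assumes "\<kappa> > 0"
    and "\<alpha> = 1 / (1 + \<kappa>)"
    and "C = (\<lambda>l. capacity (UNIV :: bool set) (\<lambda>w. 1 - exp (- \<kappa> * w))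
                  (exponential_law l) (exponential_law 1) r)"
  shows "(\<forall>l\<in>{0<..<1}. C l = ereal (l * (1 - l) / (1 - \<alpha> * l)))
    \<and> {l. is_arg_max C (\<lambda>l. l \<in> {0<..<1}) l} = {1 / \<alpha> * (1 - sqrt (1 - \<alpha>))}
    \<and> 1 / \<alpha> * (1 - sqrt (1 - \<alpha>)) = 1 / (1 + sqrt (1 - \<alpha>))"
proof -
  let ?c = "\<lambda>l. l * (1 - l) / (1 - \<alpha> * l)"
  have cap: "C l = ereal (?c l)" if "l \<in> {0<..<1}" for l
  proof -
    interpret mm1 \<kappa> l by standard (use assms(1) that in auto)
    show ?thesis
      using capacity_eq[of r] by (simp add: assms(2,3) \<rho>_def \<alpha>_def)
  qed
  \<comment> \<open>With this root \<alpha> factors as (1 - s) (1 + s), which identifies the two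
    forms of the maximizer and gives the maximum the value m^2.\<close>
  define s where "s = sqrt (1 - \<alpha>)"
  define m where "m = 1 / (1 + s)"
  have \<alpha>: "0 < \<alpha>" "\<alpha> < 1" using assms by auto
  then have s: "0 < s" "s\<^sup>2 = 1 - \<alpha>" "s < 1" by (auto simp: s_def)
  have m: "0 < m" "m < 1" using s by (auto simp: m_def)
  have \<alpha>s: "\<alpha> = (1 - s) * (1 + s)" using s(2) by (simp add: algebra_simps power2_eq_square)
  have sm: "(1 + s) * m = 1" using s by (simp add: m_def)
  then have "\<alpha> * m = 1 - s" by (simp add: \<alpha>s mult.assoc)
  then have meq: "1 / \<alpha> * (1 - s) = m" using \<alpha> by (simp add: field_simps)
  have lt: "?c l < ?c m" if l: "0 < l" "l < 1" "l \<noteq> m" for l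
  proof -
    have pos: "0 < 1 - \<alpha> * x" if "0 < x" "x < 1" for x
      using mult_strict_mono[of \<alpha> 1 x 1] \<alpha> that by simp
    have cm: "?c m = m\<^sup>2"
    proof -
      have "1 - \<alpha> * m = s" using sm by (simp add: \<alpha>s mult.assoc)
      moreover have "1 - m = s * m" using sm by (simp add: algebra_simps)
      ultimately show ?thesis using s by (simp add: power2_eq_square)
    qed
    have "(1 + s) * l \<noteq> 1" using l(3) s by (auto simp: m_def field_simps)
    then have "0 < (1 - (1 + s) * l)\<^sup>2" by simp
    also have "\<dots> = (1 - \<alpha> * l) - (1 + s)\<^sup>2 * (l * (1 - l))"
      by (simp add: \<alpha>s power2_eq_square algebra_simps)
    finally have "m\<^sup>2 * ((1 + s)\<^sup>2 * (l * (1 - l))) < m\<^sup>2 * (1 - \<alpha> * l)"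
      using m by (intro mult_strict_left_mono) auto
    moreover have "m\<^sup>2 * (1 + s)\<^sup>2 = 1" using sm by (simp add: power_mult_distrib[symmetric] mult.commute)
    ultimately have "l * (1 - l) < m\<^sup>2 * (1 - \<alpha> * l)" by (simp add: mult.assoc[symmetric])
    then show ?thesis unfolding cm using pos[OF l(1,2)] by (simp add: divide_less_eq)
  qed
  have "is_arg_max C (\<lambda>l. l \<in> {0<..<1}) l \<longleftrightarrow> l = m" for l
  proof
    assume a: "is_arg_max C (\<lambda>l. l \<in> {0<..<1}) l"
    then have l: "l \<in> {0<..<1}" and "\<not> C m > C l" using m by (auto simp: is_arg_max_def)
    then have "\<not> ?c l < ?c m" using m by (simp add: cap)
    then show "l = m" using lt[of l] l by auto
  next
    assume "l = m"
    moreover have "\<not> C m < C y" if "y \<in> {0<..<1}" for y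
      using lt[of y] that m by (cases "y = m") (auto simp: cap not_less)
    ultimately show "is_arg_max C (\<lambda>l. l \<in> {0<..<1}) l"
      using m by (auto simp: is_arg_max_def)
  qed
  then show ?thesis
    using cap meq by (auto simp: s_def[symmetric] m_def)
qed

end
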